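(* Let $(\mathcal G,\mathcal H)$ be a matched pair of étale groupoids, let $\mathscr B=(B,p)$ be a Fell bundle over $\mathcal G$, and let $\beta$ be a $(\mathcal G,\mathcal H)$-compatible $\mathcal H$-action on $\mathscr B$. Put $$C=\{(b,h)\in B\times\mathcal H: s_{\mathcal G}(p(b))=r_{\mathcal H}(h)\}$$ with the subspace topology of $B\times \mathcal H$, let $q\colon C\to\mathcal G\bowtie\mathcal H$, $q(b,h)=(p(b),h)$, and give each fibre $q^{-1}(x,h)=\mathscr B_x\times\{h\}$ the Banach space structure of $\mathscr B_x$. Define a multiplication, for $(a,g),(b,h)\in C$ with $(q(a,g),q(b,h))$ composable in $\mathcal G\bowtie\mathcal H$, by $$(a,g)\bullet(b,h)=(a\,\beta_g(b),\ g|_{p(b)}\,h),$$ and an involution by $$(b,h)^*=\bigl(\beta_{h^{-1}}(b^* ),\ h^{-1}|_{p(b)^{-1}}\bigr).$$ Then $\mathscr C=(C,q)$, with this multiplication and involution, is a Fell bundle over the Zappa-Szép product $\mathcal G\bowtie\mathcal H$. (It is denoted $\mathscr B\bowtie_\beta\mathcal H$.)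
   Context: All groupoids are locally compact Hausdorff étale; $r,s$ denote range and source. Matched pair. $\mathcal G,\mathcal H$ have the same unit space $\mathcal G^{(0)}=\mathcal H^{(0)}$, and there are continuous maps $(h,x)\mapsto h\cdot x\in\mathcal G$ and $(h,x)\mapsto h|_x\in\mathcal H$ defined on $\{(h,x)\in\mathcal H\times\mathcal G: s(h)=r(x)\}$ such that, whenever the expressions make sense: $(h_1h_2)\cdot x=h_1\cdot(h_2\cdot x)$; $r(h\cdot x)=r(h)$; $r(x)\cdot x=x$; $h|_{xy}=(h|_x)|_y$; $s(h|_x)=s(x)$; $h|_{s(h)}=h$; $s(h\cdot x)=r(h|_x)$; $h\cdot(xy)=(h\cdot x)(h|_x\cdot y)$; $(h_1h_2)|_x=h_1|_{h_2\cdot x}\,h_2|_x$. Zappa-Szép product. $\mathcal G\bowtie\mathcal H=\{(x,h)\in\mathcal G\times\mathcal H: s(x)=r(h)\}$ with the relative product topology, multiplication $(x,h)(y,g)=(x(h\cdot y),h|_y g)$ when $s(h)=r(y)$, inverse $(x,h)^{-1}=(h^{-1}\cdot x^{-1},h^{-1}|_{x^{-1}})$. It is an étale groupoid, whose unit space $\{(u,u)\}$ is identified with $\mathcal G^{(0)}=\mathcal H^{(0)}$; $r(x,h)=r(x)$, $s(x,h)=s(h)$. Fell bundle. An upper semi-continuous Banach bundle over $\mathcal G$ is a topological space $B$ with a continuous open surjection $p\colon B\to\mathcal G$ whose fibres $\mathscr B_x=p^{-1}(x)$ are complex Banach spaces such that $b\mapsto\|b\|$ is upper semi-continuous; addition is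 continuous on $\{(a,b):p(a)=p(b)\}$; for each $\lambda\in\mathbb C$, $b\mapsto\lambda b$ is continuous; and if $p(b_i)\to x$ and $\|b_i\|\to0$ then $b_i\to 0\in\mathscr B_x$. It is a Fell bundle if it has a continuous multiplication $\mathscr B^{(2)}=\{(a,b):(p(a),p(b))\in\mathcal G^{(2)}\}\to B$ and a continuous involution $b\mapsto b^*$ on $B$ such that $p(ab)=p(a)p(b)$; multiplication is bilinear and associative; $\|ab\|\le\|a\|\|b\|$; $p(b^* )=p(b)^{-1}$; the involution is conjugate linear, $(ab)^*=b^*a^*$, $b^{**}=b$; $\|b^*b\|=\|b\|^2=\|b^*\|^2$; and $b^*b\ge0$ in the $C^*$-algebra $\mathscr B_{s(p(b))}$. Compatible action. A $(\mathcal G,\mathcal H)$-compatible $\mathcal H$-action on $\mathscr B$ is a continuous map $\beta\colon\{(h,b)\in\mathcal H\times B: s(h)=r(p(b))\}\to B$, $\beta_h(b)=\beta(h,b)$, such that: $\beta_h$ maps $\mathscr B_x$ linearly into $\mathscr B_{h\cdot x}$; $\beta_{gh}=\beta_g\circ\beta_h$ for $(g,h)\in\mathcal H^{(2)}$; $\beta_u=\mathrm{id}$ for $u\in\mathcal H^{(0)}$; $\beta_h(bc)=\beta_h(b)\beta_{h|_{p(b)}}(c)$ for $(b,c)\in\mathscr B^{(2)}$; and $\beta_h(b)^*=\beta_{h|_x}(b^* )$ for $b\in\mathscr B_x$. *)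

theory Defs
  imports "HOL-Analysis.Analysis"
begin

section \<open>Etale groupoids\<close>

text \<open>
  The unit space is a topological space \<open>objects\<close> of its own, included in the space of arrows
  by the topological embedding \<open>ident\<close>; the literal convention \<open>\<G>\<^sup>(\<^sup>0\<^sup>) \<subseteq> \<G>\<close> is the
  case in which \<open>ident\<close> is the identity.  Two groupoids have the same unit space if they have
  the same \<open>objects\<close>.  All operations are total functions on types, meaningful only on
  \<open>topspace\<close> (and, for \<open>comp\<close>, on composable pairs).
\<close>

record ('u, 'g) groupoid =
  arrows :: "'g topology"
  objects :: "'u topology"
  rng :: "'g \<Rightarrow> 'u"
  src :: "'g \<Rightarrow> 'u"
  ident :: "'u \<Rightarrow> 'g"
  comp :: "'g \<Rightarrow> 'g \<Rightarrow> 'g"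
  invs :: "'g \<Rightarrow> 'g"

definition local_homeomorphism :: "'a topology \<Rightarrow> 'b topology \<Rightarrow> ('a \<Rightarrow> 'b) \<Rightarrow> bool" where
  "local_homeomorphism X Y f \<longleftrightarrow>
    (\<forall>x\<in>topspace X. \<exists>U. openin X U \<and> x \<in> U \<and> openin Y (f ` U) \<and>
       homeomorphic_map (subtopology X U) (subtopology Y (f ` U)) f)"

locale etale_groupoid =
  fixes G :: "('u, 'g) groupoid"
  assumes rng_closed: "x \<in> topspace (arrows G) \<Longrightarrow> rng G x \<in> topspace (objects G)"
    and src_closed: "x \<in> topspace (arrows G) \<Longrightarrow> src G x \<in> topspace (objects G)"
    and ident_closed: "u \<in> topspace (objects G) \<Longrightarrow> ident G u \<in> topspace (arrows G)"
    and rng_ident: "u \<in> topspace (objects G) \<Longrightarrow> rng G (ident G u) = u"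
    and src_ident: "u \<in> topspace (objects G) \<Longrightarrow> src G (ident G u) = u"
    and comp_closed: "\<lbrakk>x \<in> topspace (arrows G); y \<in> topspace (arrows G); src G x = rng G y\<rbrakk>
          \<Longrightarrow> comp G x y \<in> topspace (arrows G)"
    and rng_comp: "\<lbrakk>x \<in> topspace (arrows G); y \<in> topspace (arrows G); src G x = rng G y\<rbrakk>
          \<Longrightarrow> rng G (comp G x y) = rng G x"
    and src_comp: "\<lbrakk>x \<in> topspace (arrows G); y \<in> topspace (arrows G); src G x = rng G y\<rbrakk>
          \<Longrightarrow> src G (comp G x y) = src G y"
    and comp_assoc: "\<lbrakk>x \<in> topspace (arrows G); y \<in> topspace (arrows G); z \<in> topspace (arrows G);
            src G x = rng G y; src G y = rng G z\<rbrakk>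
          \<Longrightarrow> comp G (comp G x y) z = comp G x (comp G y z)"
    and ident_comp: "x \<in> topspace (arrows G) \<Longrightarrow> comp G (ident G (rng G x)) x = x"
    and comp_ident: "x \<in> topspace (arrows G) \<Longrightarrow> comp G x (ident G (src G x)) = x"
    and invs_closed: "x \<in> topspace (arrows G) \<Longrightarrow> invs G x \<in> topspace (arrows G)"
    and rng_invs: "x \<in> topspace (arrows G) \<Longrightarrow> rng G (invs G x) = src G x"
    and src_invs: "x \<in> topspace (arrows G) \<Longrightarrow> src G (invs G x) = rng G x"
    and comp_invs: "x \<in> topspace (arrows G) \<Longrightarrow> comp G x (invs G x) = ident G (rng G x)"
    and invs_comp: "x \<in> topspace (arrows G) \<Longrightarrow> comp G (invs G x) x = ident G (src G x)"
    and embedding_ident: "embedding_map (objects G) (arrows G) (ident G)"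
    and continuous_rng: "continuous_map (arrows G) (objects G) (rng G)"
    and continuous_src: "continuous_map (arrows G) (objects G) (src G)"
    and continuous_comp:
      "continuous_map
         (subtopology (prod_topology (arrows G) (arrows G)) {(x, y). src G x = rng G y})
         (arrows G) (\<lambda>(x, y). comp G x y)"
    and continuous_invs: "continuous_map (arrows G) (arrows G) (invs G)"
    and locally_compact: "locally_compact_space (arrows G)"
    and Hausdorff: "Hausdorff_space (arrows G)"
    and etale: "local_homeomorphism (arrows G) (objects G) (rng G)"


section \<open>Matched pairs and Zappa-Szep products\<close>

text \<open>\<open>act h x\<close> is \<open>h \<cdot> x\<close> and \<open>res h x\<close> is the restriction of \<open>h\<close> to \<open>x\<close>.\<close>

locale matched_pair = G: etale_groupoid G + H: etale_groupoid H
  for G :: "('u, 'g) groupoid" and H :: "('u, 'h) groupoid" +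
  fixes act :: "'h \<Rightarrow> 'g \<Rightarrow> 'g" and res :: "'h \<Rightarrow> 'g \<Rightarrow> 'h"
  assumes same_objects: "objects G = objects H"
    and continuous_act:
      "continuous_map
         (subtopology (prod_topology (arrows H) (arrows G)) {(h, x). src H h = rng G x})
         (arrows G) (\<lambda>(h, x). act h x)"
    and continuous_res:
      "continuous_map
         (subtopology (prod_topology (arrows H) (arrows G)) {(h, x). src H h = rng G x})
         (arrows H) (\<lambda>(h, x). res h x)"
    and comp_act: "\<lbrakk>h\<^sub>1 \<in> topspace (arrows H); h\<^sub>2 \<in> topspace (arrows H); x \<in> topspace (arrows G);
            src H h\<^sub>1 = rng H h\<^sub>2; src H h\<^sub>2 = rng G x\<rbrakk>
          \<Longrightarrow> act (comp H h\<^sub>1 h\<^sub>2) x = act h\<^sub>1 (act h\<^sub>2 x)"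
    and rng_act: "\<lbrakk>h \<in> topspace (arrows H); x \<in> topspace (arrows G); src H h = rng G x\<rbrakk>
          \<Longrightarrow> rng G (act h x) = rng H h"
    and ident_act: "x \<in> topspace (arrows G) \<Longrightarrow> act (ident H (rng G x)) x = x"
    and res_comp: "\<lbrakk>h \<in> topspace (arrows H); x \<in> topspace (arrows G); y \<in> topspace (arrows G);
            src H h = rng G x; src G x = rng G y\<rbrakk>
          \<Longrightarrow> res h (comp G x y) = res (res h x) y"
    and src_res: "\<lbrakk>h \<in> topspace (arrows H); x \<in> topspace (arrows G); src H h = rng G x\<rbrakk>
          \<Longrightarrow> src H (res h x) = src G x"
    and res_ident: "h \<in> topspace (arrows H) \<Longrightarrow> res h (ident G (src H h)) = h"
    and src_act: "\<lbrakk>h \<in> topspace (arrows H); x \<in> topspace (arrows G); src H h = rng G x\<rbrakk>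
          \<Longrightarrow> src G (act h x) = rng H (res h x)"
    and act_comp: "\<lbrakk>h \<in> topspace (arrows H); x \<in> topspace (arrows G); y \<in> topspace (arrows G);
            src H h = rng G x; src G x = rng G y\<rbrakk>
          \<Longrightarrow> act h (comp G x y) = comp G (act h x) (act (res h x) y)"
    and comp_res: "\<lbrakk>h\<^sub>1 \<in> topspace (arrows H); h\<^sub>2 \<in> topspace (arrows H); x \<in> topspace (arrows G);
            src H h\<^sub>1 = rng H h\<^sub>2; src H h\<^sub>2 = rng G x\<rbrakk>
          \<Longrightarrow> res (comp H h\<^sub>1 h\<^sub>2) x = comp H (res h\<^sub>1 (act h\<^sub>2 x)) (res h\<^sub>2 x)"

definition zappa_szep ::
  "('u, 'g) groupoid \<Rightarrow> ('u, 'h) groupoid \<Rightarrow> ('h \<Rightarrow> 'g \<Rightarrow> 'g) \<Rightarrow> ('h \<Rightarrow> 'g \<Rightarrow> 'h)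
    \<Rightarrow> ('u, 'g \<times> 'h) groupoid" where
  "zappa_szep G H act res =
    \<lparr>arrows = subtopology (prod_topology (arrows G) (arrows H)) {(x, h). src G x = rng H h},
     objects = objects G,
     rng = (\<lambda>(x, h). rng G x),
     src = (\<lambda>(x, h). src H h),
     ident = (\<lambda>u. (ident G u, ident H u)),
     comp = (\<lambda>(x, h) (y, g). (comp G x (act h y), comp H (res h y) g)),
     invs = (\<lambda>(x, h). (act (invs H h) (invs G x), res (invs H h) (invs G x)))\<rparr>"


section \<open>Upper semi-continuous Banach bundles\<close>

locale complex_banach_space =
  fixes V :: "'b set" and z :: 'b and add :: "'b \<Rightarrow> 'b \<Rightarrow> 'b"
    and scale :: "complex \<Rightarrow> 'b \<Rightarrow> 'b" and nrm :: "'b \<Rightarrow> real"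
  assumes zero_closed: "z \<in> V"
    and add_closed: "\<lbrakk>a \<in> V; b \<in> V\<rbrakk> \<Longrightarrow> add a b \<in> V"
    and scale_closed: "a \<in> V \<Longrightarrow> scale \<kappa> a \<in> V"
    and add_assoc: "\<lbrakk>a \<in> V; b \<in> V; c \<in> V\<rbrakk> \<Longrightarrow> add (add a b) c = add a (add b c)"
    and add_commute: "\<lbrakk>a \<in> V; b \<in> V\<rbrakk> \<Longrightarrow> add a b = add b a"
    and add_zero: "a \<in> V \<Longrightarrow> add a z = a"
    and add_uminus: "a \<in> V \<Longrightarrow> add a (scale (- 1) a) = z"
    and scale_one: "a \<in> V \<Longrightarrow> scale 1 a = a"
    and scale_scale: "a \<in> V \<Longrightarrow> scale \<kappa> (scale \<mu> a) = scale (\<kappa> * \<mu>) a"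
    and scale_add_right: "\<lbrakk>a \<in> V; b \<in> V\<rbrakk> \<Longrightarrow> scale \<kappa> (add a b) = add (scale \<kappa> a) (scale \<kappa> b)"
    and scale_add_left: "a \<in> V \<Longrightarrow> scale (\<kappa> + \<mu>) a = add (scale \<kappa> a) (scale \<mu> a)"
    and nrm_nonneg: "a \<in> V \<Longrightarrow> 0 \<le> nrm a"
    and nrm_eq_0_iff: "a \<in> V \<Longrightarrow> nrm a = 0 \<longleftrightarrow> a = z"
    and nrm_scale: "a \<in> V \<Longrightarrow> nrm (scale \<kappa> a) = cmod \<kappa> * nrm a"
    and nrm_triangle: "\<lbrakk>a \<in> V; b \<in> V\<rbrakk> \<Longrightarrow> nrm (add a b) \<le> nrm a + nrm b"
    and complete:
      "\<lbrakk>range \<sigma> \<subseteq> V;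
        \<And>\<epsilon>. \<epsilon> > 0 \<Longrightarrow> \<exists>N. \<forall>m\<ge>N. \<forall>n\<ge>N. nrm (add (\<sigma> m) (scale (- 1) (\<sigma> n))) < \<epsilon>\<rbrakk>
       \<Longrightarrow> \<exists>l\<in>V. (\<lambda>n. nrm (add (\<sigma> n) (scale (- 1) l))) \<longlonglongrightarrow> 0"

text \<open>
  The operations of all fibres are collected in functions on the total space, used only on
  elements of a common fibre; \<open>bzero B x\<close> is the zero vector of the fibre over \<open>x\<close>.
\<close>

record ('x, 'b) banach_bundle =
  total :: "'b topology"
  proj :: "'b \<Rightarrow> 'x"
  bzero :: "'x \<Rightarrow> 'b"
  badd :: "'b \<Rightarrow> 'b \<Rightarrow> 'b"
  bscale :: "complex \<Rightarrow> 'b \<Rightarrow> 'b"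
  bnorm :: "'b \<Rightarrow> real"

definition fibre :: "('x, 'b, 'm) banach_bundle_scheme \<Rightarrow> 'x \<Rightarrow> 'b set" where
  "fibre B x = {b \<in> topspace (total B). proj B b = x}"

text \<open>
  In the last axiom a net in the total space is replaced by a filter containing the total space
  (the image of the tail filter of the net; conversely every such filter comes from a net).
\<close>

locale usc_banach_bundle =
  fixes X :: "'x topology" and B :: "('x, 'b, 'm) banach_bundle_scheme"
  assumes continuous_proj: "continuous_map (total B) X (proj B)"
    and open_proj: "open_map (total B) X (proj B)"
    and proj_onto: "proj B ` topspace (total B) = topspace X"
    and banach_fibre: "x \<in> topspace X \<Longrightarrow>
          complex_banach_space (fibre B x) (bzero B x) (badd B) (bscale B) (bnorm B)"
    and usc_bnorm: "openin (total B) {b \<in> topspace (total B). bnorm B b < \<alpha>}"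
    and continuous_badd:
      "continuous_map
         (subtopology (prod_topology (total B) (total B)) {(a, b). proj B a = proj B b})
         (total B) (\<lambda>(a, b). badd B a b)"
    and continuous_bscale: "continuous_map (total B) (total B) (bscale B \<kappa>)"
    and limitin_bzero:
      "\<lbrakk>\<forall>\<^sub>F b in F. b \<in> topspace (total B); limitin X (proj B) x F; (bnorm B \<longlongrightarrow> 0) F\<rbrakk>
       \<Longrightarrow> limitin (total B) (\<lambda>b. b) (bzero B x) F"


section \<open>Fell bundles\<close>

record ('x, 'b) fell_bundle = "('x, 'b) banach_bundle" +
  bmult :: "'b \<Rightarrow> 'b \<Rightarrow> 'b"
  bstar :: "'b \<Rightarrow> 'b"

text \<open>
  Positivity in the (possibly non-unital) \<open>C\<^sup>*\<close>-algebra over \<open>ident G u\<close>: self-adjoint with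
  spectrum in \<open>[0, \<infinity>)\<close>.  The spectrum is computed in the unitization, whose elements are
  pairs \<open>(a, \<kappa>)\<close> representing the formal sums \<open>a + \<kappa>1\<close>.  A unit is adjoined even if the algebra has one, which
  at most adds \<open>0\<close> to the spectrum.
\<close>

definition unitization_mult ::
  "('x, 'b) fell_bundle \<Rightarrow> 'b \<times> complex \<Rightarrow> 'b \<times> complex \<Rightarrow> 'b \<times> complex" where
  "unitization_mult B = (\<lambda>(a, \<kappa>) (b, \<mu>).
     (badd B (bmult B a b) (badd B (bscale B \<kappa> b) (bscale B \<mu> a)), \<kappa> * \<mu>))"

definition fibre_spectrum :: "('x, 'b) fell_bundle \<Rightarrow> 'x \<Rightarrow> 'b \<Rightarrow> complex set" where
  "fibre_spectrum B x a =
    {\<kappa>. \<not> (\<exists>c\<in>fibre B x. \<exists>\<mu>.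
        unitization_mult B (a, - \<kappa>) (c, \<mu>) = (bzero B x, 1) \<and>
        unitization_mult B (c, \<mu>) (a, - \<kappa>) = (bzero B x, 1))}"

definition fibre_positive :: "('x, 'b) fell_bundle \<Rightarrow> 'x \<Rightarrow> 'b \<Rightarrow> bool" where
  "fibre_positive B x a \<longleftrightarrow>
    a \<in> fibre B x \<and> bstar B a = a \<and> fibre_spectrum B x a \<subseteq> \<real>\<^sub>\<ge>\<^sub>0"

locale fell_bundle = etale_groupoid G + usc_banach_bundle "arrows G" B
  for G :: "('u, 'g) groupoid" and B :: "('g, 'b) fell_bundle" +
  assumes bmult_closed: "\<lbrakk>a \<in> topspace (total B); b \<in> topspace (total B);
            src G (proj B a) = rng G (proj B b)\<rbrakk> \<Longrightarrow> bmult B a b \<in> topspace (total B)"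
    and continuous_bmult:
      "continuous_map
         (subtopology (prod_topology (total B) (total B))
            {(a, b). src G (proj B a) = rng G (proj B b)})
         (total B) (\<lambda>(a, b). bmult B a b)"
    and proj_bmult: "\<lbrakk>a \<in> topspace (total B); b \<in> topspace (total B);
            src G (proj B a) = rng G (proj B b)\<rbrakk>
          \<Longrightarrow> proj B (bmult B a b) = comp G (proj B a) (proj B b)"
    and bmult_add_left: "\<lbrakk>a \<in> topspace (total B); a' \<in> topspace (total B); b \<in> topspace (total B);
            proj B a = proj B a'; src G (proj B a) = rng G (proj B b)\<rbrakk>
          \<Longrightarrow> bmult B (badd B a a') b = badd B (bmult B a b) (bmult B a' b)"
    and bmult_add_right: "\<lbrakk>a \<in> topspace (total B); b \<in> topspace (total B); b' \<in> topspace (total B);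
            proj B b = proj B b'; src G (proj B a) = rng G (proj B b)\<rbrakk>
          \<Longrightarrow> bmult B a (badd B b b') = badd B (bmult B a b) (bmult B a b')"
    and bmult_scale_left: "\<lbrakk>a \<in> topspace (total B); b \<in> topspace (total B);
            src G (proj B a) = rng G (proj B b)\<rbrakk>
          \<Longrightarrow> bmult B (bscale B \<kappa> a) b = bscale B \<kappa> (bmult B a b)"
    and bmult_scale_right: "\<lbrakk>a \<in> topspace (total B); b \<in> topspace (total B);
            src G (proj B a) = rng G (proj B b)\<rbrakk>
          \<Longrightarrow> bmult B a (bscale B \<kappa> b) = bscale B \<kappa> (bmult B a b)"
    and bmult_assoc: "\<lbrakk>a \<in> topspace (total B); b \<in> topspace (total B); c \<in> topspace (total B);
            src G (proj B a) = rng G (proj B b); src G (proj B b) = rng G (proj B c)\<rbrakk>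
          \<Longrightarrow> bmult B (bmult B a b) c = bmult B a (bmult B b c)"
    and bnorm_bmult: "\<lbrakk>a \<in> topspace (total B); b \<in> topspace (total B);
            src G (proj B a) = rng G (proj B b)\<rbrakk>
          \<Longrightarrow> bnorm B (bmult B a b) \<le> bnorm B a * bnorm B b"
    and continuous_bstar: "continuous_map (total B) (total B) (bstar B)"
    and proj_bstar: "b \<in> topspace (total B) \<Longrightarrow> proj B (bstar B b) = invs G (proj B b)"
    and bstar_add: "\<lbrakk>a \<in> topspace (total B); b \<in> topspace (total B); proj B a = proj B b\<rbrakk>
          \<Longrightarrow> bstar B (badd B a b) = badd B (bstar B a) (bstar B b)"
    and bstar_scale: "b \<in> topspace (total B) \<Longrightarrow>
          bstar B (bscale B \<kappa> b) = bscale B (cnj \<kappa>) (bstar B b)"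
    and bstar_bmult: "\<lbrakk>a \<in> topspace (total B); b \<in> topspace (total B);
            src G (proj B a) = rng G (proj B b)\<rbrakk>
          \<Longrightarrow> bstar B (bmult B a b) = bmult B (bstar B b) (bstar B a)"
    and bstar_bstar: "b \<in> topspace (total B) \<Longrightarrow> bstar B (bstar B b) = b"
    and bnorm_bstar_bmult: "b \<in> topspace (total B) \<Longrightarrow>
          bnorm B (bmult B (bstar B b) b) = (bnorm B b)\<^sup>2"
    and bnorm_bstar: "b \<in> topspace (total B) \<Longrightarrow> (bnorm B b)\<^sup>2 = (bnorm B (bstar B b))\<^sup>2"
    and bstar_bmult_positive: "b \<in> topspace (total B) \<Longrightarrow>
          fibre_positive B (ident G (src G (proj B b))) (bmult B (bstar B b) b)"


section \<open>Compatible actions\<close>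

locale compatible_action = matched_pair G H act res + fell_bundle G B
  for G :: "('u, 'g) groupoid" and H :: "('u, 'h) groupoid"
    and act :: "'h \<Rightarrow> 'g \<Rightarrow> 'g" and res :: "'h \<Rightarrow> 'g \<Rightarrow> 'h"
    and B :: "('g, 'b) fell_bundle" +
  fixes \<beta> :: "'h \<Rightarrow> 'b \<Rightarrow> 'b"
  assumes continuous_beta:
      "continuous_map
         (subtopology (prod_topology (arrows H) (total B)) {(h, b). src H h = rng G (proj B b)})
         (total B) (\<lambda>(h, b). \<beta> h b)"
    and beta_fibre: "\<lbrakk>h \<in> topspace (arrows H); b \<in> topspace (total B); src H h = rng G (proj B b)\<rbrakk>
          \<Longrightarrow> \<beta> h b \<in> fibre B (act h (proj B b))"
    and beta_add: "\<lbrakk>h \<in> topspace (arrows H); a \<in> topspace (total B); b \<in> topspace (total B);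
            proj B a = proj B b; src H h = rng G (proj B b)\<rbrakk>
          \<Longrightarrow> \<beta> h (badd B a b) = badd B (\<beta> h a) (\<beta> h b)"
    and beta_scale: "\<lbrakk>h \<in> topspace (arrows H); b \<in> topspace (total B); src H h = rng G (proj B b)\<rbrakk>
          \<Longrightarrow> \<beta> h (bscale B \<kappa> b) = bscale B \<kappa> (\<beta> h b)"
    and beta_comp: "\<lbrakk>g \<in> topspace (arrows H); h \<in> topspace (arrows H); b \<in> topspace (total B);
            src H g = rng H h; src H h = rng G (proj B b)\<rbrakk>
          \<Longrightarrow> \<beta> (comp H g h) b = \<beta> g (\<beta> h b)"
    and beta_ident: "b \<in> topspace (total B) \<Longrightarrow> \<beta> (ident H (rng G (proj B b))) b = b"
    and beta_bmult: "\<lbrakk>h \<in> topspace (arrows H); b \<in> topspace (total B); c \<in> topspace (total B);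
            src H h = rng G (proj B b); src G (proj B b) = rng G (proj B c)\<rbrakk>
          \<Longrightarrow> \<beta> h (bmult B b c) = bmult B (\<beta> h b) (\<beta> (res h (proj B b)) c)"
    and beta_bstar: "\<lbrakk>h \<in> topspace (arrows H); b \<in> topspace (total B); src H h = rng G (proj B b)\<rbrakk>
          \<Longrightarrow> bstar B (\<beta> h b) = \<beta> (res h (proj B b)) (bstar B b)"


section \<open>The Zappa-Szep product bundle\<close>

text \<open>
  In \<open>badd\<close> the second components agree whenever the two arguments lie in a common fibre.
\<close>

definition zappa_szep_bundle ::
  "('u, 'g) groupoid \<Rightarrow> ('u, 'h) groupoid \<Rightarrow> ('h \<Rightarrow> 'g \<Rightarrow> 'h) \<Rightarrow> ('g, 'b) fell_bundle
    \<Rightarrow> ('h \<Rightarrow> 'b \<Rightarrow> 'b) \<Rightarrow> ('g \<times> 'h, 'b \<times> 'h) fell_bundle" where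
  "zappa_szep_bundle G H res B \<beta> =
    \<lparr>total = subtopology (prod_topology (total B) (arrows H)) {(b, h). src G (proj B b) = rng H h},
     proj = (\<lambda>(b, h). (proj B b, h)),
     bzero = (\<lambda>(x, h). (bzero B x, h)),
     badd = (\<lambda>(a, h) (b, _). (badd B a b, h)),
     bscale = (\<lambda>\<kappa> (b, h). (bscale B \<kappa> b, h)),
     bnorm = (\<lambda>(b, h). bnorm B b),
     bmult = (\<lambda>(a, g) (b, h). (bmult B a (\<beta> g b), comp H (res g (proj B b)) h)),
     bstar = (\<lambda>(b, h). (\<beta> (invs H h) (bstar B b), res (invs H h) (invs G (proj B b))))\<rparr>"

end

theory Submission
  imports Defs
begin

text \<open>
  Each axiom for \<open>\<B> \<bowtie> \<H>\<close> has two coordinates.  The second coordinates are computed in the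
  Zappa-Szep groupoid, so the first task is to show that this is an etale groupoid
  (\<open>etale_groupoid_zappa_szep\<close>); its algebra follows from the identities of a matched pair,
  and its topology from the fact that it is a closed subspace of \<open>\<G> \<times> \<H>\<close> whose range map
  inherits openness and local injectivity from the range maps of the factors.  The first
  coordinates of the algebraic axioms follow from the compatibility of \<open>\<beta>\<close> with products,
  involution and composition.

  Two points need an idea beyond such computations.

  Norms: submultiplicativity and the two norm identities for the involution require that every
  \<open>\<beta>\<^sub>h\<close> is isometric, although only continuity of \<open>\<beta>\<close> is assumed.  Continuity makes
  \<open>\<beta>\<^sub>h\<close> bounded on each fibre (\<open>continuous_fibre_map_bounded\<close>), because the topology of
  the bundle sees norms near the zero vectors.  Over units \<open>\<beta>\<^sub>h\<close> is a bounded
  \<open>*\<close>-homomorphism between \<open>C\<^sup>*\<close>-algebras, and the \<open>C\<^sup>*\<close>-identity applied to the powers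
  of a self-adjoint element with exponents \<open>2 ^ n\<close> turns any bound into the bound \<open>1\<close>.
  The general case follows by applying this to \<open>b\<^sup>* b\<close> (\<open>bnorm_beta_le\<close>), and
  equality by using the inverse of \<open>h\<close> (\<open>bnorm_beta\<close>).

  Positivity: the element \<open>(b, h)\<^sup>* \<bullet> (b, h)\<close> is the image of \<open>b\<^sup>* b\<close> under the
  \<open>*\<close>-homomorphism given by \<open>h\<^sup>-\<^sup>1\<close> (\<open>bstar_bmult_self_zappa_szep_bundle\<close>), and
  \<open>*\<close>-homomorphisms do not enlarge spectra (\<open>fibre_positive_beta\<close>).
\<close>


section \<open>Local homeomorphisms\<close>

lemma local_homeomorphism_imp_open_map:
  assumes "local_homeomorphism X Y f"
  shows "open_map X Y f"
  unfolding open_map_def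
proof (intro allI impI)
  fix W assume W: "openin X W"
  have "\<exists>T. openin Y T \<and> f x \<in> T \<and> T \<subseteq> f ` W" if "x \<in> W" for x
  proof -
    have "x \<in> topspace X" using W that openin_subset by blast
    then obtain U where U: "openin X U" "x \<in> U" "openin Y (f ` U)"
      and hom: "homeomorphic_map (subtopology X U) (subtopology Y (f ` U)) f"
      using assms unfolding local_homeomorphism_def by blast
    have "openin (subtopology X U) (U \<inter> W)"
      using W by (rule openin_subtopology_Int2)
    then have "openin (subtopology Y (f ` U)) (f ` (U \<inter> W))"
      using homeomorphic_imp_open_map[OF hom] by (simp add: open_map_def)
    then have "openin Y (f ` (U \<inter> W))"
      using U openin_trans_full by blast
    then show ?thesis using U that by blast
  qed
  then show "openin Y (f ` W)"
    by (subst openin_subopen) blast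
qed

lemma local_homeomorphism_imp_locally_inj:
  assumes "local_homeomorphism X Y f" and "x \<in> topspace X"
  obtains U where "openin X U" "x \<in> U" "inj_on f U"
proof -
  obtain U where U: "openin X U" "x \<in> U"
    and hom: "homeomorphic_map (subtopology X U) (subtopology Y (f ` U)) f"
    using assms unfolding local_homeomorphism_def by blast
  then have "inj_on f U"
    using homeomorphic_imp_injective_map[OF hom] openin_subset[OF U(1)]
    by (simp add: Int_absorb1)
  then show thesis using U that by blast
qed

text \<open>
  Etaleness of the product is checked with this criterion: openness of the range map and local
  injectivity can each be read off separately from the two factors.
\<close>

lemma local_homeomorphismI:
  assumes cont: "continuous_map X Y f" and opn: "open_map X Y f"
    and inj: "\<And>x. x \<in> topspace X \<Longrightarrow> \<exists>U. openin X U \<and> x \<in> U \<and> inj_on f U"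
  shows "local_homeomorphism X Y f"
  unfolding local_homeomorphism_def
proof
  fix x assume "x \<in> topspace X"
  then obtain U where U: "openin X U" "x \<in> U" "inj_on f U" using inj by blast
  have top: "topspace (subtopology X U) = U" "topspace (subtopology Y (f ` U)) = f ` U"
    using openin_subset[OF U(1)] continuous_map_image_subset_topspace[OF cont] by auto
  have "homeomorphic_map (subtopology X U) (subtopology Y (f ` U)) f"
  proof (rule bijective_open_imp_homeomorphic_map)
    show "continuous_map (subtopology X U) (subtopology Y (f ` U)) f"
      using cont top by (auto simp: continuous_map_in_subtopology continuous_map_from_subtopology)
    show "open_map (subtopology X U) (subtopology Y (f ` U)) f"
      using open_map_from_subtopology[OF opn U(1)] top
      by (intro open_map_into_subtopology) auto
  qed (use top U in auto)
  moreover have "openin Y (f ` U)" using opn U by (simp add: open_map_def)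
  ultimately show "\<exists>U. openin X U \<and> x \<in> U \<and> openin Y (f ` U) \<and>
      homeomorphic_map (subtopology X U) (subtopology Y (f ` U)) f"
    using U by blast
qed

text \<open>
  All operations at hand are continuous only on a set of composable pairs.  This rule composes
  such a partial operation with two maps whose values are composable.
\<close>

lemma continuous_map_binary:
  assumes F: "continuous_map (subtopology (prod_topology X Y) S) W (\<lambda>(x, y). F x y)"
    and f: "continuous_map Z X f" and g: "continuous_map Z Y g"
    and S: "\<And>z. z \<in> topspace Z \<Longrightarrow> (f z, g z) \<in> S"
  shows "continuous_map Z W (\<lambda>z. F (f z) (g z))"
proof -
  have "continuous_map Z (subtopology (prod_topology X Y) S) (\<lambda>z. (f z, g z))"
    using f g S by (auto simp: continuous_map_in_subtopology continuous_map_paired)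
  from continuous_map_compose[OF this F] show ?thesis by (simp add: o_def)
qed


section \<open>Groupoid arithmetic\<close>

context etale_groupoid
begin

lemma Hausdorff_objects: "Hausdorff_space (objects G)"
  using embedding_map_imp_homeomorphic_space[OF embedding_ident] Hausdorff
    homeomorphic_Hausdorff_space Hausdorff_space_subtopology by blast

lemma continuous_ident: "continuous_map (objects G) (arrows G) (ident G)"
  using embedding_ident
  by (simp add: embedding_map_def homeomorphic_eq_everything_map continuous_map_in_subtopology)

lemma invs_unique:
  assumes "x \<in> topspace (arrows G)" "y \<in> topspace (arrows G)" "src G x = rng G y"
    and "comp G x y = ident G (rng G x)"
  shows "y = invs G x"
proof -
  have "y = comp G (comp G (invs G x) x) y"
    using assms by (simp add: invs_comp ident_comp)
  also have "\<dots> = comp G (invs G x) (comp G x y)"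
    using assms by (intro comp_assoc) (auto simp: invs_closed src_invs)
  also have "\<dots> = invs G x"
    using assms comp_ident[of "invs G x"] by (simp add: invs_closed src_invs)
  finally show ?thesis .
qed

lemma invs_invs: "x \<in> topspace (arrows G) \<Longrightarrow> invs G (invs G x) = x"
  using invs_unique[of "invs G x" x] by (simp add: invs_closed src_invs rng_invs invs_comp)

lemma invs_of_comp:
  assumes "x \<in> topspace (arrows G)" "y \<in> topspace (arrows G)" "src G x = rng G y"
  shows "invs G (comp G x y) = comp G (invs G y) (invs G x)"
proof -
  note [simp] = assms invs_closed src_invs rng_invs comp_closed rng_comp src_comp
  have "comp G (comp G x y) (comp G (invs G y) (invs G x))
      = comp G x (comp G (comp G y (invs G y)) (invs G x))"
    by (simp add: comp_assoc)
  also have "\<dots> = ident G (rng G (comp G x y))"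
    using ident_comp[of "invs G x"] by (simp add: comp_invs)
  finally show ?thesis
    by (intro invs_unique[symmetric]) auto
qed

text \<open>
  In a matched pair nothing says directly that \<open>h \<cdot> u\<close> and \<open>u|\<^sub>x\<close> are units for a unit
  \<open>u\<close>.  Both are idempotent, and cancellation in a groupoid leaves only units.
\<close>

lemma idempotent_is_ident:
  assumes "x \<in> topspace (arrows G)" "src G x = rng G x" "comp G x x = x"
  shows "x = ident G (rng G x)"
proof -
  have "x = comp G (comp G (invs G x) x) x"
    using assms ident_comp[of x] by (simp add: invs_comp)
  also have "\<dots> = comp G (invs G x) (comp G x x)"
    using assms by (intro comp_assoc) (auto simp: invs_closed src_invs)
  finally show ?thesis
    using assms by (simp add: invs_comp)
qed

end


section \<open>Identities in a matched pair\<close>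

context matched_pair
begin

lemma act_closed:
  "\<lbrakk>h \<in> topspace (arrows H); x \<in> topspace (arrows G); src H h = rng G x\<rbrakk>
    \<Longrightarrow> act h x \<in> topspace (arrows G)"
  using continuous_map_image_subset_topspace[OF continuous_act] by force

lemma res_closed:
  "\<lbrakk>h \<in> topspace (arrows H); x \<in> topspace (arrows G); src H h = rng G x\<rbrakk>
    \<Longrightarrow> res h x \<in> topspace (arrows H)"
  using continuous_map_image_subset_topspace[OF continuous_res] by force

text \<open>
  In these rules the common unit space is always written as that of \<open>H\<close>, so that the
  side conditions on both groupoids meet in one normal form.
\<close>

lemmas rng_src_simps =
  act_closed res_closed rng_act src_act src_res
  G.comp_closed G.rng_comp G.src_comp G.invs_closed G.rng_invs G.src_invs
  G.rng_closed[unfolded same_objects] G.src_closed[unfolded same_objects]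
  G.ident_closed[unfolded same_objects] G.rng_ident[unfolded same_objects]
  G.src_ident[unfolded same_objects]
  H.comp_closed H.rng_comp H.src_comp H.invs_closed H.rng_invs H.src_invs
  H.rng_closed H.src_closed H.ident_closed H.rng_ident H.src_ident

lemma act_ident:
  assumes "h \<in> topspace (arrows H)"
  shows "act h (ident G (src H h)) = ident G (rng H h)"
proof -
  let ?u = "ident G (src H h)"
  note [simp] = assms rng_src_simps res_ident
  have "comp G ?u ?u = ?u" using G.ident_comp[of ?u] by simp
  then have "comp G (act h ?u) (act h ?u) = act h ?u"
    using act_comp[of h ?u ?u] by simp
  then show ?thesis
    using G.idempotent_is_ident[of "act h ?u"] by simp
qed

lemma res_of_ident:
  assumes "x \<in> topspace (arrows G)"
  shows "res (ident H (rng G x)) x = ident H (src G x)"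
proof -
  let ?u = "ident H (rng G x)"
  note [simp] = assms rng_src_simps ident_act
  have rng: "rng H (res ?u x) = src G x"
    using src_act[of ?u x] by simp
  have "comp H ?u ?u = ?u" using H.ident_comp[of ?u] by simp
  then have "comp H (res ?u x) (res ?u x) = res ?u x"
    using comp_res[of ?u ?u x] by simp
  then show ?thesis
    using H.idempotent_is_ident[of "res ?u x"] rng by simp
qed

lemma act_invs_act:
  assumes "h \<in> topspace (arrows H)" "x \<in> topspace (arrows G)" "src H h = rng G x"
  shows "act (invs H h) (act h x) = x"
  using comp_act[of "invs H h" h x] assms by (simp add: rng_src_simps H.invs_comp ident_act)

lemma res_res_invs:
  assumes "h \<in> topspace (arrows H)" "x \<in> topspace (arrows G)" "src H h = rng G x"
  shows "res (res h x) (invs G x) = h"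
  using res_comp[of h x "invs G x"] assms res_ident[of h]
  by (simp add: rng_src_simps G.comp_invs)

text \<open>
  Restricting \<open>h\<^sup>-\<^sup>1 h = s(h)\<close> to \<open>x\<close> exhibits the restriction of \<open>h\<^sup>-\<^sup>1\<close> to
  \<open>h \<cdot> x\<close> as a left inverse of \<open>h|\<^sub>x\<close>.
\<close>

lemma invs_res:
  assumes "h \<in> topspace (arrows H)" "x \<in> topspace (arrows G)" "src H h = rng G x"
  shows "invs H (res h x) = res (invs H h) (act h x)"
proof -
  have "comp H (res (invs H h) (act h x)) (res h x) = ident H (src G x)"
    using comp_res[of "invs H h" h x] assms
    by (simp add: rng_src_simps H.invs_comp res_of_ident)
  moreover have "rng H (res (invs H h) (act h x)) = src G x"
    using src_act[of "invs H h" "act h x"] assms by (simp add: rng_src_simps act_invs_act)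
  ultimately have "res h x = invs H (res (invs H h) (act h x))"
    using assms by (intro H.invs_unique) (simp_all add: rng_src_simps)
  then show ?thesis
    using assms by (simp add: rng_src_simps H.invs_invs)
qed


section \<open>The Zappa-Szep product is an etale groupoid\<close>

abbreviation "Z \<equiv> zappa_szep G H act res"

lemma zappa_szep_simps:
  "arrows Z = subtopology (prod_topology (arrows G) (arrows H)) {(x, h). src G x = rng H h}"
  "objects Z = objects G"
  "rng Z (x, h) = rng G x" "src Z (x, h) = src H h" "ident Z u = (ident G u, ident H u)"
  "comp Z (x, h) (y, g) = (comp G x (act h y), comp H (res h y) g)"
  "invs Z (x, h) = (act (invs H h) (invs G x), res (invs H h) (invs G x))"
  by (simp_all add: zappa_szep_def)

lemma topspace_zappa_szep:
  "(x, h) \<in> topspace (arrows Z) \<longleftrightarrow>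
    x \<in> topspace (arrows G) \<and> h \<in> topspace (arrows H) \<and> src G x = rng H h"
  by (auto simp: zappa_szep_simps)

lemma continuous_zappa_szep_proj:
  "continuous_map (arrows Z) (arrows G) fst" "continuous_map (arrows Z) (arrows H) snd"
  by (auto simp: zappa_szep_simps intro: continuous_map_from_subtopology
      continuous_map_fst continuous_map_snd)

lemma continuous_into_zappa_szep:
  assumes "continuous_map X (arrows G) f" "continuous_map X (arrows H) g"
    and "\<And>z. z \<in> topspace X \<Longrightarrow> src G (f z) = rng H (g z)"
  shows "continuous_map X (arrows Z) (\<lambda>z. (f z, g z))"
  using assms by (auto simp: zappa_szep_simps continuous_map_in_subtopology continuous_map_paired)

lemma rng_zappa_szep_eq: "rng Z = rng G \<circ> fst"
  by (auto simp: zappa_szep_def)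

lemma src_zappa_szep_eq: "src Z = src H \<circ> snd"
  by (auto simp: zappa_szep_def)

lemma continuous_rng_zappa_szep: "continuous_map (arrows Z) (objects G) (rng Z)"
  unfolding rng_zappa_szep_eq
  by (rule continuous_map_compose[OF continuous_zappa_szep_proj(1) G.continuous_rng])

lemma continuous_comp_zappa_szep:
  "continuous_map
     (subtopology (prod_topology (arrows Z) (arrows Z)) {(z, w). src Z z = rng Z w})
     (arrows Z) (\<lambda>(z, w). comp Z z w)"
proof -
  let ?D = "subtopology (prod_topology (arrows Z) (arrows Z)) {(z, w). src Z z = rng Z w}"
  have D: "continuous_map ?D (arrows Z) fst" "continuous_map ?D (arrows Z) snd"
    by (auto intro: continuous_map_from_subtopology continuous_map_fst continuous_map_snd)
  note proj = continuous_zappa_szep_proj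
  have c: "continuous_map ?D (arrows G) (\<lambda>p. fst (fst p))"
    "continuous_map ?D (arrows H) (\<lambda>p. snd (fst p))"
    "continuous_map ?D (arrows G) (\<lambda>p. fst (snd p))"
    "continuous_map ?D (arrows H) (\<lambda>p. snd (snd p))"
    using continuous_map_compose[OF D(1) proj(1)] continuous_map_compose[OF D(1) proj(2)]
      continuous_map_compose[OF D(2) proj(1)] continuous_map_compose[OF D(2) proj(2)]
    by (simp_all add: o_def)
  have mem: "fst (fst p) \<in> topspace (arrows G)" "snd (fst p) \<in> topspace (arrows H)"
      "fst (snd p) \<in> topspace (arrows G)" "snd (snd p) \<in> topspace (arrows H)"
      "src G (fst (fst p)) = rng H (snd (fst p))" "src G (fst (snd p)) = rng H (snd (snd p))"
      "src H (snd (fst p)) = rng G (fst (snd p))"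
    if "p \<in> topspace ?D" for p
    using that by (auto simp: zappa_szep_simps)
  have "continuous_map ?D (arrows Z)
     (\<lambda>p. (comp G (fst (fst p)) (act (snd (fst p)) (fst (snd p))),
           comp H (res (snd (fst p)) (fst (snd p))) (snd (snd p))))"
    by (intro continuous_into_zappa_szep continuous_map_binary[OF G.continuous_comp]
        continuous_map_binary[OF H.continuous_comp] continuous_map_binary[OF continuous_act]
        continuous_map_binary[OF continuous_res] c)
      (use mem in \<open>auto simp: rng_src_simps\<close>)
  then show ?thesis
    by (rule continuous_map_eq) (auto simp: zappa_szep_def)
qed

lemma continuous_invs_zappa_szep: "continuous_map (arrows Z) (arrows Z) (invs Z)"
proof -
  have i: "continuous_map (arrows Z) (arrows G) (\<lambda>p. invs G (fst p))"
    "continuous_map (arrows Z) (arrows H) (\<lambda>p. invs H (snd p))"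
    using continuous_map_compose[OF continuous_zappa_szep_proj(1) G.continuous_invs]
      continuous_map_compose[OF continuous_zappa_szep_proj(2) H.continuous_invs]
    by (simp_all add: o_def)
  have "continuous_map (arrows Z) (arrows Z)
     (\<lambda>p. (act (invs H (snd p)) (invs G (fst p)), res (invs H (snd p)) (invs G (fst p))))"
    by (intro continuous_into_zappa_szep continuous_map_binary[OF continuous_act]
        continuous_map_binary[OF continuous_res] i)
      (auto simp: zappa_szep_simps rng_src_simps)
  then show ?thesis
    by (rule continuous_map_eq) (auto simp: zappa_szep_def)
qed

text \<open>
  The unit space embeds into the Hausdorff space of arrows, so the equation
  \<open>s(x) = r(h)\<close> is a closed condition; local compactness passes to closed subspaces.
\<close>

lemma closedin_zappa_szep:
  "closedin (prod_topology (arrows G) (arrows H))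
     (topspace (prod_topology (arrows G) (arrows H)) \<inter> {(x, h). src G x = rng H h})"
proof -
  let ?P = "prod_topology (arrows G) (arrows H)"
  have "continuous_map ?P (objects G) (src G \<circ> fst)"
    using G.continuous_src by (rule continuous_map_compose[OF continuous_map_fst])
  moreover have "continuous_map ?P (objects G) (rng H \<circ> snd)"
    using H.continuous_rng unfolding same_objects
    by (rule continuous_map_compose[OF continuous_map_snd])
  ultimately have "closedin ?P {p \<in> topspace ?P. (src G \<circ> fst) p = (rng H \<circ> snd) p}"
    by (rule closedin_continuous_maps_eq[OF G.Hausdorff_objects])
  moreover have "{p \<in> topspace ?P. (src G \<circ> fst) p = (rng H \<circ> snd) p}
      = topspace ?P \<inter> {(x, h). src G x = rng H h}" by auto
  ultimately show ?thesis by simp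
qed

lemma locally_compact_zappa_szep: "locally_compact_space (arrows Z)"
proof -
  have "locally_compact_space (prod_topology (arrows G) (arrows H))"
    using G.locally_compact H.locally_compact by (simp add: locally_compact_space_prod_topology)
  from locally_compact_space_closed_subset[OF this closedin_zappa_szep]
  show ?thesis
    by (simp only: zappa_szep_simps subtopology_restrict)
qed

text \<open>
  Over a box \<open>U \<times> V\<close> the range map has image \<open>r(U \<inter> s\<^sup>-\<^sup>1(r(V)))\<close>, which is open
  because both range maps are open.  If both are injective on \<open>U\<close> and \<open>V\<close>, then \<open>r(x)\<close>
  determines \<open>x\<close>, hence \<open>r(h) = s(x)\<close>, hence \<open>h\<close>.
\<close>

lemma etale_zappa_szep: "local_homeomorphism (arrows Z) (objects G) (rng Z)"
proof (rule local_homeomorphismI[OF continuous_rng_zappa_szep])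
  have openG: "open_map (arrows G) (objects G) (rng G)"
    using G.etale by (rule local_homeomorphism_imp_open_map)
  have openH: "open_map (arrows H) (objects G) (rng H)"
    using H.etale unfolding same_objects by (rule local_homeomorphism_imp_open_map)
  show "open_map (arrows Z) (objects G) (rng Z)"
    unfolding open_map_def
  proof (intro allI impI)
    fix W assume W: "openin (arrows Z) W"
    then obtain W' where W': "openin (prod_topology (arrows G) (arrows H)) W'"
      and WW': "W = W' \<inter> {(x, h). src G x = rng H h}"
      by (auto simp: zappa_szep_simps openin_subtopology)
    have "\<exists>T. openin (objects G) T \<and> rng Z z \<in> T \<and> T \<subseteq> rng Z ` W" if "z \<in> W" for z
    proof -
      obtain x h where z: "z = (x, h)" "(x, h) \<in> W'" "src G x = rng H h"
        using \<open>z \<in> W\<close> WW' by auto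
      obtain U V where UV: "openin (arrows G) U" "openin (arrows H) V"
        "x \<in> U" "h \<in> V" "U \<times> V \<subseteq> W'"
        using openin_prod_topology_alt[THEN iffD1, OF W', rule_format, OF z(2)] by blast
      let ?U = "U \<inter> {y \<in> topspace (arrows G). src G y \<in> rng H ` V}"
      have "openin (objects G) (rng H ` V)"
        using openH UV by (simp add: open_map_def)
      then have "openin (arrows G) ?U"
        using UV by (intro openin_Int openin_continuous_map_preimage[OF G.continuous_src])
      then have "openin (objects G) (rng G ` ?U)"
        using openG by (simp add: open_map_def)
      moreover have "rng Z z \<in> rng G ` ?U"
        using z UV openin_subset[OF UV(1)] by (auto simp: zappa_szep_simps)
      moreover have "rng G ` ?U \<subseteq> rng Z ` W"
      proof
        fix u assume "u \<in> rng G ` ?U"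
        then obtain y k where "u = rng G y" "y \<in> U" "k \<in> V" "src G y = rng H k" by blast
        then have "(y, k) \<in> W" "u = rng Z (y, k)"
          using UV WW' by (auto simp: zappa_szep_simps)
        then show "u \<in> rng Z ` W" by blast
      qed
      ultimately show ?thesis by blast
    qed
    then show "openin (objects G) (rng Z ` W)"
      by (subst openin_subopen) blast
  qed
next
  fix z assume z: "z \<in> topspace (arrows Z)"
  obtain x h where xh: "z = (x, h)" by (cases z)
  then have mem: "x \<in> topspace (arrows G)" "h \<in> topspace (arrows H)"
    using z topspace_zappa_szep by auto
  obtain U where U: "openin (arrows G) U" "x \<in> U" "inj_on (rng G) U"
    by (rule local_homeomorphism_imp_locally_inj[OF G.etale mem(1)])
  obtain V where V: "openin (arrows H) V" "h \<in> V" "inj_on (rng H) V"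
    by (rule local_homeomorphism_imp_locally_inj[OF H.etale mem(2)])
  let ?W = "(U \<times> V) \<inter> {(x, h). src G x = rng H h}"
  have "openin (arrows Z) ?W"
    unfolding zappa_szep_simps openin_subtopology
    using U V by (intro exI[of _ "U \<times> V"]) (simp add: openin_prod_Times_iff)
  moreover have "z \<in> ?W" using z U V by (auto simp: xh topspace_zappa_szep)
  moreover have "inj_on (rng Z) ?W"
  proof (rule inj_onI)
    fix p p' assume p: "p \<in> ?W" and p': "p' \<in> ?W" and eq: "rng Z p = rng Z p'"
    obtain y k y' k' where s: "p = (y, k)" "p' = (y', k')" by (cases p, cases p')
    have "y = y'"
      using inj_onD[OF U(3), of y y'] p p' eq by (auto simp: s zappa_szep_simps)
    moreover from this have "k = k'"
      using inj_onD[OF V(3), of k k'] p p' by (auto simp: s)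
    ultimately show "p = p'" by (simp add: s)
  qed
  ultimately show "\<exists>W. openin (arrows Z) W \<and> z \<in> W \<and> inj_on (rng Z) W" by blast
qed

text \<open>
  The axioms of a groupoid are the identities of a matched pair, read one coordinate at a time.
  The inverse laws come from letting \<open>h h\<^sup>-\<^sup>1\<close> act on and restrict to \<open>x\<^sup>-\<^sup>1\<close>, and from
  \<open>h\<^sup>-\<^sup>1\<close> acting on and restricting to \<open>x\<^sup>-\<^sup>1 x\<close>.
\<close>

theorem etale_groupoid_zappa_szep: "etale_groupoid Z"
proof (rule etale_groupoid.intro)
  note [simp] = rng_src_simps topspace_zappa_szep zappa_szep_simps(2-)
  show "rng Z z \<in> topspace (objects Z)" if "z \<in> topspace (arrows Z)" for z
    using that by (cases z) (simp add: same_objects)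
  show "src Z z \<in> topspace (objects Z)" if "z \<in> topspace (arrows Z)" for z
    using that by (cases z) (simp add: same_objects)
  show "ident Z u \<in> topspace (arrows Z)" "rng Z (ident Z u) = u" "src Z (ident Z u) = u"
    if "u \<in> topspace (objects Z)" for u
    using that by (simp_all add: same_objects)
  show "comp Z z w \<in> topspace (arrows Z)" "rng Z (comp Z z w) = rng Z z"
    "src Z (comp Z z w) = src Z w"
    if "z \<in> topspace (arrows Z)" "w \<in> topspace (arrows Z)" "src Z z = rng Z w" for z w
    using that by (cases z; cases w; simp)+
  show "comp Z (comp Z z w) v = comp Z z (comp Z w v)"
    if "z \<in> topspace (arrows Z)" "w \<in> topspace (arrows Z)" "v \<in> topspace (arrows Z)"
      "src Z z = rng Z w" "src Z w = rng Z v" for z w v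
    using that
    by (cases z; cases w; cases v)
      (simp add: G.comp_assoc H.comp_assoc act_comp comp_act res_comp comp_res)
  show "comp Z (ident Z (rng Z z)) z = z" if "z \<in> topspace (arrows Z)" for z
    using that by (cases z) (simp add: ident_act res_of_ident G.ident_comp H.ident_comp)
  show "comp Z z (ident Z (src Z z)) = z" if "z \<in> topspace (arrows Z)" for z
  proof -
    obtain x h where z: "z = (x, h)" by (cases z)
    then show ?thesis
      using that G.comp_ident[of x] by (simp add: act_ident res_ident H.comp_ident)
  qed
  show "invs Z z \<in> topspace (arrows Z)" "rng Z (invs Z z) = src Z z"
    "src Z (invs Z z) = rng Z z" if "z \<in> topspace (arrows Z)" for z
    using that by (cases z; simp)+
  show "comp Z z (invs Z z) = ident Z (rng Z z)" if "z \<in> topspace (arrows Z)" for z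
  proof -
    obtain x h where z: "z = (x, h)" by (cases z)
    then show ?thesis
      using that comp_act[of h "invs H h" "invs G x"] comp_res[of h "invs H h" "invs G x"]
        ident_act[of "invs G x"] res_of_ident[of "invs G x"]
      by (simp add: H.comp_invs G.comp_invs)
  qed
  show "comp Z (invs Z z) z = ident Z (src Z z)" if "z \<in> topspace (arrows Z)" for z
  proof -
    obtain x h where z: "z = (x, h)" by (cases z)
    then show ?thesis
      using that act_comp[of "invs H h" "invs G x" x] res_comp[of "invs H h" "invs G x" x]
        act_ident[of "invs H h"] res_ident[of "invs H h"]
      by (simp add: H.invs_comp G.invs_comp)
  qed
  \<comment> \<open>The range map is a continuous left inverse of the unit map, which is therefore an embedding.\<close>
  have "continuous_map (objects G) (arrows Z) (\<lambda>u. (ident G u, ident H u))"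
    using G.continuous_ident H.continuous_ident
    by (intro continuous_into_zappa_szep) (simp_all add: same_objects)
  then have "section_map (objects G) (arrows Z) (ident Z)"
    unfolding section_map_def retraction_maps_def
    using continuous_rng_zappa_szep
    by (intro exI[of _ "rng Z"]) (simp add: zappa_szep_def same_objects rng_src_simps)
  then show "embedding_map (objects Z) (arrows Z) (ident Z)"
    by (simp add: section_imp_embedding_map)
  show "continuous_map (arrows Z) (objects Z) (rng Z)"
    using continuous_rng_zappa_szep by simp
  show "continuous_map (arrows Z) (objects Z) (src Z)"
    using continuous_map_compose[OF continuous_zappa_szep_proj(2) H.continuous_src]
    by (simp add: src_zappa_szep_eq same_objects)
  show "Hausdorff_space (arrows Z)"
    unfolding zappa_szep_simps
    by (intro Hausdorff_space_subtopology) (simp add: Hausdorff_space_prod_topology G.Hausdorff H.Hausdorff)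
  show "local_homeomorphism (arrows Z) (objects Z) (rng Z)"
    using etale_zappa_szep by simp
qed (rule continuous_comp_zappa_szep continuous_invs_zappa_szep locally_compact_zappa_szep)+

end


section \<open>Continuous linear maps between fibres\<close>

context usc_banach_bundle
begin

lemma proj_closed: "b \<in> topspace (total B) \<Longrightarrow> proj B b \<in> topspace X"
  using proj_onto by blast

lemma banach_fibre_proj:
  "b \<in> topspace (total B) \<Longrightarrow>
    complex_banach_space (fibre B (proj B b)) (bzero B (proj B b)) (badd B) (bscale B) (bnorm B)"
  by (rule banach_fibre[OF proj_closed])

lemma bzero_in_fibre: "x \<in> topspace X \<Longrightarrow> bzero B x \<in> fibre B x"
  using banach_fibre by (rule complex_banach_space.zero_closed)

lemma
  assumes "a \<in> topspace (total B)" "b \<in> topspace (total B)" "proj B a = proj B b"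
  shows badd_closed: "badd B a b \<in> topspace (total B)"
    and proj_badd: "proj B (badd B a b) = proj B b"
  using complex_banach_space.add_closed[OF banach_fibre_proj[of b], of a b] assms
  by (auto simp: fibre_def)

lemma
  assumes "b \<in> topspace (total B)"
  shows bscale_closed: "bscale B \<kappa> b \<in> topspace (total B)"
    and proj_bscale: "proj B (bscale B \<kappa> b) = proj B b"
  using complex_banach_space.scale_closed[OF banach_fibre_proj[of b], of b] assms
  by (auto simp: fibre_def)

lemma bnorm_nonneg: "b \<in> topspace (total B) \<Longrightarrow> 0 \<le> bnorm B b"
  by (rule complex_banach_space.nrm_nonneg[OF banach_fibre_proj]) (simp_all add: fibre_def)

lemma bnorm_bscale: "b \<in> topspace (total B) \<Longrightarrow> bnorm B (bscale B \<kappa> b) = cmod \<kappa> * bnorm B b"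
  by (rule complex_banach_space.nrm_scale[OF banach_fibre_proj]) (simp_all add: fibre_def)

lemma bnorm_bzero: "x \<in> topspace X \<Longrightarrow> bnorm B (bzero B x) = 0"
  using complex_banach_space.nrm_eq_0_iff[OF banach_fibre bzero_in_fibre] by blast

lemma bscale_0: "b \<in> topspace (total B) \<Longrightarrow> bscale B 0 b = bzero B (proj B b)"
  using complex_banach_space.scale_add_left[OF banach_fibre_proj, of b b 1 "-1"]
    complex_banach_space.scale_one[OF banach_fibre_proj, of b b]
    complex_banach_space.add_uminus[OF banach_fibre_proj, of b b]
  by (simp add: fibre_def)

text \<open>
  The norm need not be continuous, but it still controls the topology near the zero vectors:
  vectors in one fibre with norms tending to \<open>0\<close> converge to the zero vector, and by upper
  semi-continuity the vectors of norm below \<open>1\<close> form an open set.  If \<open>T\<close> were unbounded,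
  rescaling would give a null sequence whose images all have norm \<open>1\<close>, contradicting
  continuity at the zero vector.
\<close>

lemma continuous_fibre_map_bounded:
  assumes x: "x \<in> topspace X" and y: "y \<in> topspace X"
    and cont: "continuous_map (subtopology (total B) (fibre B x)) (total B) T"
    and fib: "\<And>a. a \<in> fibre B x \<Longrightarrow> T a \<in> fibre B y"
    and scale: "\<And>a \<kappa>. a \<in> fibre B x \<Longrightarrow> T (bscale B \<kappa> a) = bscale B \<kappa> (T a)"
  shows "\<exists>K. \<forall>a\<in>fibre B x. bnorm B (T a) \<le> K * bnorm B a"
proof (rule ccontr)
  assume "\<not> ?thesis"
  then have "\<forall>n::nat. \<exists>a\<in>fibre B x. real n * bnorm B a < bnorm B (T a)"
    by (metis not_le)
  then obtain a where a: "\<And>n. a n \<in> fibre B x"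
    and large: "\<And>n. real n * bnorm B (a n) < bnorm B (T (a n))"
    by metis
  have total: "a n \<in> topspace (total B)" "T (a n) \<in> topspace (total B)" for n
    using a fib by (auto simp: fibre_def)
  have pos: "bnorm B (T (a n)) > 0" for n
    using large[of n] bnorm_nonneg[OF total(1), of n]
    by (meson less_le_trans mult_nonneg_nonneg not_le of_nat_0_le_iff order_less_le_trans)
  define b where "b n = bscale B (complex_of_real (1 / bnorm B (T (a n)))) (a n)" for n
  have b: "b n \<in> fibre B x" for n
    using a[of n] total by (simp add: b_def fibre_def bscale_closed proj_bscale)
  have norm_Tb: "bnorm B (T (b n)) = 1" for n
    using pos[of n] by (simp add: b_def scale a bnorm_bscale total norm_divide)
  have norm_b: "bnorm B (b n) \<le> inverse (real n)" if "n > 0" for n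
    using large[of n] pos[of n] that
    by (simp add: b_def bnorm_bscale total norm_divide field_simps)
  have "(\<lambda>n. bnorm B (b n)) \<longlonglongrightarrow> 0"
  proof (rule tendsto_sandwich[OF _ _ tendsto_const lim_inverse_n])
    show "\<forall>\<^sub>F n in sequentially. 0 \<le> bnorm B (b n)"
      using b by (auto simp: fibre_def bnorm_nonneg)
    show "\<forall>\<^sub>F n in sequentially. bnorm B (b n) \<le> inverse (real n)"
      using eventually_gt_at_top[of "0::nat"] by eventually_elim (rule norm_b)
  qed
  moreover have "proj B (b n) = x" "b n \<in> topspace (total B)" for n
    using b[of n] by (auto simp: fibre_def)
  ultimately have "limitin (total B) (\<lambda>b. b) (bzero B x) (filtermap b sequentially)"
    using x by (intro limitin_bzero)
      (simp_all add: eventually_filtermap filterlim_filtermap limitin_def)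
  then have lim: "\<forall>\<^sub>F n in sequentially. b n \<in> W" if "openin (total B) W" "bzero B x \<in> W" for W
    using that by (simp add: limitin_def eventually_filtermap)
  let ?V = "{c \<in> topspace (total B). bnorm B c < 1}"
  have "openin (subtopology (total B) (fibre B x))
      {c \<in> topspace (subtopology (total B) (fibre B x)). T c \<in> ?V}"
    using cont usc_bnorm by (rule openin_continuous_map_preimage)
  then obtain W where W: "openin (total B) W"
    and pre: "{c \<in> topspace (subtopology (total B) (fibre B x)). T c \<in> ?V} = W \<inter> fibre B x"
    unfolding openin_subtopology by blast
  have fibre_sub: "fibre B x \<subseteq> topspace (total B)" by (auto simp: fibre_def)
  have zero: "bzero B x \<in> fibre B x" by (rule bzero_in_fibre[OF x])
  then have "T (bzero B x) = bzero B y"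
    using scale[OF zero, of 0] bscale_0[of "bzero B x"] bscale_0[of "T (bzero B x)"] fib[OF zero]
    by (simp add: fibre_def)
  then have "T (bzero B x) \<in> ?V"
    using fib[OF zero] y by (simp add: bnorm_bzero fibre_def)
  then have "bzero B x \<in> {c \<in> topspace (subtopology (total B) (fibre B x)). T c \<in> ?V}"
    using zero fibre_sub by auto
  then have "bzero B x \<in> W" unfolding pre by simp
  then have "\<forall>\<^sub>F n in sequentially. b n \<in> W" by (rule lim[OF W])
  then obtain n where "b n \<in> W" using eventually_happens'[OF sequentially_bot] by blast
  then have "bnorm B (T (b n)) < 1" using pre b by blast
  then show False by (simp add: norm_Tb)
qed

end


section \<open>A compatible action is isometric\<close>

text \<open>
  A constant factor is invisible to the growth of high powers.
\<close>

lemma le_if_power_le: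
  fixes r s K :: real
  assumes "0 \<le> r" "0 \<le> s" and pow: "\<And>n. r ^ (2 ^ n) \<le> K * s ^ (2 ^ n)"
  shows "r \<le> s"
proof (rule ccontr)
  assume "\<not> r \<le> s"
  then have rs: "s < r" by simp
  show False
  proof (cases "s = 0")
    case True
    then show False using pow[of 0] rs by simp
  next
    case False
    then have s: "0 < s" using assms by simp
    then have r1: "1 < r / s" using rs by simp
    obtain n where n: "K < (r / s) ^ n" using real_arch_pow[OF r1] by blast
    also have "\<dots> \<le> (r / s) ^ (2 ^ n)"
      using r1 by (intro power_increasing) (simp_all add: less_imp_le)
    also have "\<dots> \<le> K"
      using pow[of n] s by (simp add: power_divide divide_le_eq)
    finally show False by simp
  qed
qed

context compatible_action
begin

lemma
  assumes "h \<in> topspace (arrows H)" "b \<in> topspace (total B)" "src H h = rng G (proj B b)"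
  shows beta_closed: "\<beta> h b \<in> topspace (total B)"
    and proj_beta: "proj B (\<beta> h b) = act h (proj B b)"
  using beta_fibre[OF assms] by (simp_all add: fibre_def)

lemma bstar_closed: "b \<in> topspace (total B) \<Longrightarrow> bstar B b \<in> topspace (total B)"
  using continuous_map_image_subset_topspace[OF continuous_bstar] by blast

lemmas bundle_simps = rng_src_simps bmult_closed proj_bmult bstar_closed proj_bstar
  beta_closed proj_beta proj_closed badd_closed proj_badd bscale_closed proj_bscale

lemma continuous_beta_fibre:
  assumes h: "h \<in> topspace (arrows H)" "src H h = rng G x"
  shows "continuous_map (subtopology (total B) (fibre B x)) (total B) (\<beta> h)"
proof (rule continuous_map_binary[OF continuous_beta, of _ "\<lambda>_. h" "\<lambda>b. b"])
  show "continuous_map (subtopology (total B) (fibre B x)) (arrows H) (\<lambda>_. h)"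
    using h by simp
  show "continuous_map (subtopology (total B) (fibre B x)) (total B) (\<lambda>b. b)"
    by (simp add: continuous_map_from_subtopology)
qed (use h in \<open>auto simp: fibre_def\<close>)

lemma beta_bounded:
  assumes h: "h \<in> topspace (arrows H)" "x \<in> topspace (arrows G)" "src H h = rng G x"
  shows "\<exists>K. \<forall>a\<in>fibre B x. bnorm B (\<beta> h a) \<le> K * bnorm B a"
proof (rule continuous_fibre_map_bounded)
  show "continuous_map (subtopology (total B) (fibre B x)) (total B) (\<beta> h)"
    using h by (intro continuous_beta_fibre)
  show "\<beta> h a \<in> fibre B (act h x)" if "a \<in> fibre B x" for a
    using that h beta_fibre by (auto simp: fibre_def)
  show "\<beta> h (bscale B \<kappa> a) = bscale B \<kappa> (\<beta> h a)" if "a \<in> fibre B x" for a \<kappa>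
    using that h beta_scale by (auto simp: fibre_def)
qed (use h act_closed in auto)

text \<open>
  Over a unit, \<open>\<beta>\<^sub>h\<close> is a \<open>*\<close>-homomorphism, since there \<open>h|\<^sub>u = h\<close>.  Repeated
  squaring of a self-adjoint \<open>a\<close> squares the norms of both \<open>a\<close> and \<open>\<beta>\<^sub>h(a)\<close>, by the
  \<open>C\<^sup>*\<close>-identity.  A bound \<open>\<parallel>\<beta>\<^sub>h(c)\<parallel> \<le> K \<parallel>c\<parallel>\<close> applied to these powers therefore
  sharpens to \<open>K = 1\<close>.  This replaces the usual argument by spectral radii.
\<close>

lemma bnorm_beta_le_selfadjoint:
  assumes h: "h \<in> topspace (arrows H)" and a: "a \<in> fibre B (ident G (src H h))"
    and sa: "bstar B a = a"
  shows "bnorm B (\<beta> h a) \<le> bnorm B a"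
proof -
  let ?e = "ident G (src H h)"
  note [simp] = h bundle_simps res_ident
  have e: "?e \<in> topspace (arrows G)" "rng G ?e = src H h" "comp G ?e ?e = ?e"
    using G.ident_comp[of ?e] by simp_all
  obtain K where K: "\<And>c. c \<in> fibre B ?e \<Longrightarrow> bnorm B (\<beta> h c) \<le> K * bnorm B c"
    using beta_bounded[of h ?e] by auto
  \<comment> \<open>\<open>p n\<close> is the power of \<open>a\<close> with exponent \<open>2 ^ n\<close>.\<close>
  define p where "p n = ((\<lambda>c. bmult B c c) ^^ n) a" for n
  have p: "p n \<in> fibre B ?e \<and> bstar B (p n) = p n \<and> bnorm B (p n) = bnorm B a ^ (2 ^ n) \<and>
      bnorm B (\<beta> h (p n)) = bnorm B (\<beta> h a) ^ (2 ^ n)" for n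
  proof (induction n)
    case 0
    then show ?case using a sa by (simp add: p_def)
  next
    case (Suc n)
    then have c: "p n \<in> topspace (total B)" "proj B (p n) = ?e" "bstar B (p n) = p n"
      and nrm: "bnorm B (p n) = bnorm B a ^ (2 ^ n)"
        "bnorm B (\<beta> h (p n)) = bnorm B (\<beta> h a) ^ (2 ^ n)"
      by (simp_all add: fibre_def)
    have Suc_p: "p (Suc n) = bmult B (p n) (p n)" by (simp add: p_def)
    have "bstar B (\<beta> h (p n)) = \<beta> h (p n)"
      using beta_bstar[of h "p n"] c by simp
    then have "bnorm B (bmult B (\<beta> h (p n)) (\<beta> h (p n))) = (bnorm B (\<beta> h (p n)))\<^sup>2"
      using bnorm_bstar_bmult[of "\<beta> h (p n)"] c by simp
    then have "bnorm B (\<beta> h (p (Suc n))) = bnorm B (\<beta> h a) ^ (2 ^ Suc n)"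
      using beta_bmult[of h "p n" "p n"] c nrm(2)
      by (simp add: Suc_p flip: power_mult) (simp add: mult.commute)
    moreover have "bnorm B (p (Suc n)) = bnorm B a ^ (2 ^ Suc n)"
      using bnorm_bstar_bmult[of "p n"] c nrm(1)
      by (simp add: Suc_p flip: power_mult) (simp add: mult.commute)
    moreover have "p (Suc n) \<in> fibre B ?e" "bstar B (p (Suc n)) = p (Suc n)"
      using c e bstar_bmult[of "p n" "p n"] by (simp_all add: Suc_p fibre_def)
    ultimately show ?case by blast
  qed
  have "bnorm B (\<beta> h a) ^ (2 ^ n) \<le> K * bnorm B a ^ (2 ^ n)" for n
    using K[of "p n"] p[of n] by metis
  moreover have "a \<in> topspace (total B)" "\<beta> h a \<in> topspace (total B)"
    using a by (simp_all add: fibre_def)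
  ultimately show ?thesis
    by (intro le_if_power_le[OF bnorm_nonneg bnorm_nonneg])
qed

text \<open>
  The \<open>C\<^sup>*\<close>-identity reduces the claim to the self-adjoint case over a unit, because
  \<open>(h|\<^sub>x)|\<^sub>y = h\<close> for \<open>y = x\<^sup>-\<^sup>1\<close> turns \<open>\<beta>\<^sub>h(b)\<^sup>* \<beta>\<^sub>h(b)\<close> into the image of \<open>b\<^sup>* b\<close> under the action of
  \<open>h|\<^sub>x\<close>, and \<open>b\<^sup>* b\<close> is self-adjoint and lies over a unit.
\<close>

lemma bnorm_beta_le:
  assumes h: "h \<in> topspace (arrows H)" "b \<in> topspace (total B)" "src H h = rng G (proj B b)"
  shows "bnorm B (\<beta> h b) \<le> bnorm B b"
proof -
  let ?k = "res h (proj B b)" and ?c = "bmult B (bstar B b) b"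
  note [simp] = assms bundle_simps
  have "bmult B (bstar B (\<beta> h b)) (\<beta> h b) = \<beta> ?k ?c"
    using beta_bmult[of ?k "bstar B b" b] by (simp add: beta_bstar res_res_invs)
  then have "(bnorm B (\<beta> h b))\<^sup>2 = bnorm B (\<beta> ?k ?c)"
    using bnorm_bstar_bmult[of "\<beta> h b"] by simp
  also have "\<dots> \<le> bnorm B ?c"
    using bstar_bmult[of "bstar B b" b]
    by (intro bnorm_beta_le_selfadjoint) (simp_all add: fibre_def G.invs_comp bstar_bstar)
  also have "\<dots> = (bnorm B b)\<^sup>2" by (simp add: bnorm_bstar_bmult)
  finally show ?thesis
    by (rule power2_le_imp_le) (simp add: bnorm_nonneg)
qed

lemma beta_invs_beta:
  assumes "h \<in> topspace (arrows H)" "b \<in> topspace (total B)" "src H h = rng G (proj B b)"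
  shows "\<beta> (invs H h) (\<beta> h b) = b"
  using beta_comp[of "invs H h" h b] assms by (simp add: bundle_simps H.invs_comp beta_ident)

lemma bnorm_beta:
  assumes h: "h \<in> topspace (arrows H)" "b \<in> topspace (total B)" "src H h = rng G (proj B b)"
  shows "bnorm B (\<beta> h b) = bnorm B b"
  using bnorm_beta_le[OF assms] bnorm_beta_le[of "invs H h" "\<beta> h b"] assms
  by (simp add: bundle_simps beta_invs_beta)

lemma beta_bzero:
  assumes "h \<in> topspace (arrows H)" "x \<in> topspace (arrows G)" "src H h = rng G x"
  shows "\<beta> h (bzero B x) = bzero B (act h x)"
proof -
  have z: "bzero B x \<in> topspace (total B)" "proj B (bzero B x) = x"
    using bzero_in_fibre[OF assms(2)] by (auto simp: fibre_def)
  then have "\<beta> h (bscale B 0 (bzero B x)) = bscale B 0 (\<beta> h (bzero B x))"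
    using assms by (intro beta_scale) auto
  then show ?thesis using assms z by (simp add: bscale_0 bundle_simps)
qed

end


section \<open>The Banach bundle over the Zappa-Szep product\<close>

lemma complex_banach_space_Times_singleton:
  assumes "complex_banach_space V z add smul nrm"
  shows "complex_banach_space (V \<times> {h}) (z, h) (\<lambda>(a, h) (b, _). (add a b, h))
    (\<lambda>\<kappa> (b, h). (smul \<kappa> b, h)) (\<lambda>(b, h). nrm b)"
proof -
  interpret V: complex_banach_space V z add smul nrm by fact
  show ?thesis
  proof
    fix \<sigma> :: "nat \<Rightarrow> 'a \<times> 'b"
    assume \<sigma>: "range \<sigma> \<subseteq> V \<times> {h}"
      and cauchy: "\<And>\<epsilon>. \<epsilon> > 0 \<Longrightarrow> \<exists>N. \<forall>m\<ge>N. \<forall>n\<ge>N. (\<lambda>(b, h). nrm b)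
        ((\<lambda>(a, h) (b, _). (add a b, h)) (\<sigma> m) ((\<lambda>\<kappa> (b, h). (smul \<kappa> b, h)) (- 1) (\<sigma> n))) < \<epsilon>"
    have "range (fst \<circ> \<sigma>) \<subseteq> V"
      using \<sigma> by (simp add: image_subset_iff mem_Times_iff)
    moreover have "\<exists>N. \<forall>m\<ge>N. \<forall>n\<ge>N. nrm (add ((fst \<circ> \<sigma>) m) (smul (- 1) ((fst \<circ> \<sigma>) n))) < \<epsilon>"
      if "\<epsilon> > 0" for \<epsilon>
      using cauchy[OF that] by (simp add: case_prod_unfold)
    ultimately obtain l where "l \<in> V" "(\<lambda>n. nrm (add ((fst \<circ> \<sigma>) n) (smul (- 1) l))) \<longlonglongrightarrow> 0"
      using V.complete by blast
    then show "\<exists>l\<in>V \<times> {h}. (\<lambda>n. (\<lambda>(b, h). nrm b)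
        ((\<lambda>(a, h) (b, _). (add a b, h)) (\<sigma> n) ((\<lambda>\<kappa> (b, h). (smul \<kappa> b, h)) (- 1) l))) \<longlonglongrightarrow> 0"
      by (intro bexI[of _ "(l, h)"]) (auto simp: case_prod_unfold)
  qed (auto simp: V.zero_closed V.add_closed V.scale_closed V.add_assoc V.add_zero V.add_uminus
      V.scale_one V.scale_scale V.scale_add_right V.scale_add_left V.nrm_nonneg V.nrm_eq_0_iff
      V.nrm_scale V.nrm_triangle intro: V.add_commute)
qed

context compatible_action
begin

abbreviation "C \<equiv> zappa_szep_bundle G H res B \<beta>"

lemma zappa_szep_bundle_simps:
  "total C = subtopology (prod_topology (total B) (arrows H)) {(b, h). src G (proj B b) = rng H h}"
  "proj C (b, h) = (proj B b, h)" "bzero C (x, h) = (bzero B x, h)"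
  "badd C (a, g) (b, h) = (badd B a b, g)" "bscale C \<kappa> (b, h) = (bscale B \<kappa> b, h)"
  "bnorm C (b, h) = bnorm B b"
  "bmult C (a, g) (b, h) = (bmult B a (\<beta> g b), comp H (res g (proj B b)) h)"
  "bstar C (b, h) = (\<beta> (invs H h) (bstar B b), res (invs H h) (invs G (proj B b)))"
  by (simp_all add: zappa_szep_bundle_def)

lemma topspace_zappa_szep_bundle:
  "(b, h) \<in> topspace (total C) \<longleftrightarrow>
    b \<in> topspace (total B) \<and> h \<in> topspace (arrows H) \<and> src G (proj B b) = rng H h"
  by (auto simp: zappa_szep_bundle_simps)

lemma continuous_zappa_szep_bundle_fst: "continuous_map (total C) (total B) fst"
  and continuous_zappa_szep_bundle_snd: "continuous_map (total C) (arrows H) snd"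
  by (auto simp: zappa_szep_bundle_simps intro: continuous_map_from_subtopology
      continuous_map_fst continuous_map_snd)

lemma continuous_into_zappa_szep_bundle:
  assumes "continuous_map X (total B) f" "continuous_map X (arrows H) g"
    and "\<And>z. z \<in> topspace X \<Longrightarrow> src G (proj B (f z)) = rng H (g z)"
  shows "continuous_map X (total C) (\<lambda>z. (f z, g z))"
  using assms
  by (auto simp: zappa_szep_bundle_simps continuous_map_in_subtopology continuous_map_paired)

lemma continuous_proj_zappa_szep_bundle: "continuous_map (total C) (arrows Z) (proj C)"
proof -
  have "continuous_map (total C) (arrows Z) (\<lambda>c. (proj B (fst c), snd c))"
    using continuous_map_compose[OF continuous_zappa_szep_bundle_fst continuous_proj]
      continuous_zappa_szep_bundle_snd
    by (intro continuous_into_zappa_szep) (auto simp: o_def topspace_zappa_szep_bundle)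
  then show ?thesis
    by (rule continuous_map_eq) (auto simp: zappa_szep_bundle_def)
qed

text \<open>
  The product of \<open>p\<close> with the identity is open, and it stays open when restricted to the
  full preimage \<open>C\<close> of the Zappa-Szep product.
\<close>

lemma open_proj_zappa_szep_bundle: "open_map (total C) (arrows Z) (proj C)"
proof -
  let ?P = "\<lambda>(b, h). (proj B b, h)"
  let ?S = "{(x, h). src G x = rng H h}"
  let ?T = "topspace (prod_topology (total B) (arrows H)) \<inter> {(b, h). src G (proj B b) = rng H h}"
  have "open_map (prod_topology (total B) (arrows H)) (prod_topology (arrows G) (arrows H)) ?P"
    unfolding open_map_def
  proof (intro allI impI)
    fix W assume W: "openin (prod_topology (total B) (arrows H)) W"
    have "\<exists>U V. openin (arrows G) U \<and> openin (arrows H) V \<and> x \<in> U \<and> h \<in> V \<and> U \<times> V \<subseteq> ?P ` W"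
      if "(x, h) \<in> ?P ` W" for x h
    proof -
      obtain b where b: "(b, h) \<in> W" "x = proj B b" using \<open>(x, h) \<in> ?P ` W\<close> by auto
      obtain U V where UV: "openin (total B) U" "openin (arrows H) V" "b \<in> U" "h \<in> V" "U \<times> V \<subseteq> W"
        using openin_prod_topology_alt[THEN iffD1, OF W, rule_format, OF b(1)] by blast
      have "openin (arrows G) (proj B ` U)"
        using open_proj UV(1) by (simp add: open_map_def)
      moreover have "proj B ` U \<times> V \<subseteq> ?P ` W" using UV(5) by force
      ultimately show ?thesis using UV b by blast
    qed
    then show "openin (prod_topology (arrows G) (arrows H)) (?P ` W)"
      by (simp add: openin_prod_topology_alt)
  qed
  then have "open_map (subtopology (prod_topology (total B) (arrows H)) ?T)
      (subtopology (prod_topology (arrows G) (arrows H)) ?S) ?P"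
    by (rule open_map_restriction) auto
  then show ?thesis
    by (simp only: subtopology_restrict zappa_szep_simps zappa_szep_bundle_def banach_bundle.simps)
qed

lemma proj_onto_zappa_szep_bundle: "proj C ` topspace (total C) = topspace (arrows Z)"
proof
  show "proj C ` topspace (total C) \<subseteq> topspace (arrows Z)"
    by (rule continuous_map_image_subset_topspace[OF continuous_proj_zappa_szep_bundle])
  show "topspace (arrows Z) \<subseteq> proj C ` topspace (total C)"
  proof
    fix z assume z: "z \<in> topspace (arrows Z)"
    obtain x h where xh: "z = (x, h)" by (cases z)
    then have x: "x \<in> topspace (arrows G)" "h \<in> topspace (arrows H)" "src G x = rng H h"
      using z by (simp_all add: topspace_zappa_szep)
    obtain b where "b \<in> topspace (total B)" "x = proj B b"
      using x(1) proj_onto by blast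
    then show "z \<in> proj C ` topspace (total C)"
      using x by (intro image_eqI[of _ _ "(b, h)"])
        (simp_all add: xh zappa_szep_bundle_simps(2) topspace_zappa_szep_bundle)
  qed
qed

lemma fibre_zappa_szep_bundle:
  assumes "(x, h) \<in> topspace (arrows Z)"
  shows "fibre C (x, h) = fibre B x \<times> {h}"
  using assms unfolding topspace_zappa_szep
  by (auto simp: fibre_def zappa_szep_bundle_simps(2) topspace_zappa_szep_bundle)

text \<open>
  The vector space operations and the norm see only the first coordinate.  For the condition on
  vanishing norms, the filter is pushed forward to \<open>B\<close>, where it converges to the zero vector; in the second coordinate
  the convergence is that of the base points.
\<close>

theorem usc_banach_bundle_zappa_szep: "usc_banach_bundle (arrows Z) C"
proof (rule usc_banach_bundle.intro)
  show "complex_banach_space (fibre C z) (bzero C z) (badd C) (bscale C) (bnorm C)"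
    if z: "z \<in> topspace (arrows Z)" for z
  proof -
    obtain x h where xh: "z = (x, h)" by (cases z)
    then have "complex_banach_space (fibre B x) (bzero B x) (badd B) (bscale B) (bnorm B)"
      using z by (intro banach_fibre) (simp add: topspace_zappa_szep)
    from complex_banach_space_Times_singleton[OF this, of h]
    show ?thesis
      using fibre_zappa_szep_bundle[of x h] z unfolding xh by (simp add: zappa_szep_bundle_def)
  qed
  show "openin (total C) {c \<in> topspace (total C). bnorm C c < \<alpha>}" for \<alpha>
  proof -
    have "openin (total C) {c \<in> topspace (total C). fst c \<in> {b \<in> topspace (total B). bnorm B b < \<alpha>}}"
      using continuous_zappa_szep_bundle_fst usc_bnorm by (rule openin_continuous_map_preimage)
    also have "{c \<in> topspace (total C). fst c \<in> {b \<in> topspace (total B). bnorm B b < \<alpha>}}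
        = {c \<in> topspace (total C). bnorm C c < \<alpha>}"
      by (auto simp: topspace_zappa_szep_bundle zappa_szep_bundle_simps(6))
    finally show ?thesis .
  qed
  show "continuous_map
         (subtopology (prod_topology (total C) (total C)) {(a, b). proj C a = proj C b})
         (total C) (\<lambda>(a, b). badd C a b)"
  proof -
    let ?D = "subtopology (prod_topology (total C) (total C)) {(a, b). proj C a = proj C b}"
    have D: "continuous_map ?D (total C) fst" "continuous_map ?D (total C) snd"
      by (auto intro: continuous_map_from_subtopology continuous_map_fst continuous_map_snd)
    have c: "continuous_map ?D (total B) (\<lambda>p. fst (fst p))"
      "continuous_map ?D (arrows H) (\<lambda>p. snd (fst p))"
      "continuous_map ?D (total B) (\<lambda>p. fst (snd p))"
      using continuous_map_compose[OF D(1) continuous_zappa_szep_bundle_fst]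
        continuous_map_compose[OF D(1) continuous_zappa_szep_bundle_snd]
        continuous_map_compose[OF D(2) continuous_zappa_szep_bundle_fst]
      by (simp_all add: o_def)
    have "continuous_map ?D (total C) (\<lambda>p. (badd B (fst (fst p)) (fst (snd p)), snd (fst p)))"
      by (intro continuous_into_zappa_szep_bundle continuous_map_binary[OF continuous_badd] c)
        (auto simp: topspace_zappa_szep_bundle zappa_szep_bundle_simps(2) proj_badd)
    then show ?thesis
      by (rule continuous_map_eq) (auto simp: zappa_szep_bundle_def)
  qed
  show "continuous_map (total C) (total C) (bscale C \<kappa>)" for \<kappa>
  proof -
    have "continuous_map (total C) (total C) (\<lambda>c. (bscale B \<kappa> (fst c), snd c))"
      using continuous_map_compose[OF continuous_zappa_szep_bundle_fst continuous_bscale]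
        continuous_zappa_szep_bundle_snd
      by (intro continuous_into_zappa_szep_bundle)
        (auto simp: o_def topspace_zappa_szep_bundle proj_bscale)
    then show ?thesis
      by (rule continuous_map_eq) (auto simp: zappa_szep_bundle_def)
  qed
  show "limitin (total C) (\<lambda>c. c) (bzero C z) F"
    if total: "\<forall>\<^sub>F c in F. c \<in> topspace (total C)" and lim: "limitin (arrows Z) (proj C) z F"
      and norm: "(bnorm C \<longlongrightarrow> 0) F" for z F
  proof -
    obtain x h where xh: "z = (x, h)" by (cases z)
    have z: "x \<in> topspace (arrows G)" "h \<in> topspace (arrows H)" "src G x = rng H h"
      using limitin_topspace[OF lim] by (simp_all add: xh topspace_zappa_szep)
    have lim_x: "limitin (arrows G) (proj B \<circ> fst) x F" and lim_h: "limitin (arrows H) snd h F"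
      using lim by (simp_all add: xh zappa_szep_simps(1) limitin_subtopology limitin_pairwise
          zappa_szep_bundle_def o_def case_prod_unfold)
    have "limitin (total B) (\<lambda>b. b) (bzero B x) (filtermap fst F)"
    proof (rule limitin_bzero)
      show "\<forall>\<^sub>F b in filtermap fst F. b \<in> topspace (total B)"
        unfolding eventually_filtermap using total
        by eventually_elim (auto simp: topspace_zappa_szep_bundle)
      show "limitin (arrows G) (proj B) x (filtermap fst F)"
        using lim_x by (simp add: limitin_def eventually_filtermap)
      show "(bnorm B \<longlongrightarrow> 0) (filtermap fst F)"
        using norm by (simp add: filterlim_filtermap zappa_szep_bundle_def case_prod_unfold)
    qed
    then have "limitin (total B) fst (bzero B x) F"
      by (simp add: limitin_def eventually_filtermap)
    moreover have "\<forall>\<^sub>F c in F. c \<in> {(b, h). src G (proj B b) = rng H h}"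
      using total by eventually_elim (auto simp: topspace_zappa_szep_bundle)
    moreover have "proj B (bzero B x) = x"
      using bzero_in_fibre[OF z(1)] by (simp add: fibre_def)
    ultimately show ?thesis
      using lim_h z by (simp add: xh zappa_szep_bundle_simps limitin_subtopology limitin_pairwise o_def)
  qed
qed (rule continuous_proj_zappa_szep_bundle open_proj_zappa_szep_bundle
    proj_onto_zappa_szep_bundle)+


section \<open>The Fell bundle structure\<close>

text \<open>
  The equations for the two topologies are left out, so that membership is rewritten to conditions
  on the coordinates instead of to a subspace of a product.
\<close>

lemmas prod_simps = zappa_szep_simps(2-) zappa_szep_bundle_simps(2-) topspace_zappa_szep
  topspace_zappa_szep_bundle

lemma continuous_bmult_zappa_szep_bundle:
  "continuous_map
     (subtopology (prod_topology (total C) (total C)) {(a, b). src Z (proj C a) = rng Z (proj C b)})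
     (total C) (\<lambda>(a, b). bmult C a b)"
proof -
  let ?D = "subtopology (prod_topology (total C) (total C))
    {(a, b). src Z (proj C a) = rng Z (proj C b)}"
  have D: "continuous_map ?D (total C) fst" "continuous_map ?D (total C) snd"
    by (auto intro: continuous_map_from_subtopology continuous_map_fst continuous_map_snd)
  have c: "continuous_map ?D (total B) (\<lambda>p. fst (fst p))"
    "continuous_map ?D (arrows H) (\<lambda>p. snd (fst p))"
    "continuous_map ?D (total B) (\<lambda>p. fst (snd p))"
    "continuous_map ?D (arrows H) (\<lambda>p. snd (snd p))"
    using continuous_map_compose[OF D(1) continuous_zappa_szep_bundle_fst]
      continuous_map_compose[OF D(1) continuous_zappa_szep_bundle_snd]
      continuous_map_compose[OF D(2) continuous_zappa_szep_bundle_fst]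
      continuous_map_compose[OF D(2) continuous_zappa_szep_bundle_snd]
    by (simp_all add: o_def)
  have proj: "continuous_map ?D (arrows G) (\<lambda>p. proj B (fst (snd p)))"
    using continuous_map_compose[OF c(3) continuous_proj] by (simp add: o_def)
  have mem: "fst (fst p) \<in> topspace (total B)" "snd (fst p) \<in> topspace (arrows H)"
      "fst (snd p) \<in> topspace (total B)" "snd (snd p) \<in> topspace (arrows H)"
      "src G (proj B (fst (fst p))) = rng H (snd (fst p))"
      "src G (proj B (fst (snd p))) = rng H (snd (snd p))"
      "src H (snd (fst p)) = rng G (proj B (fst (snd p)))"
    if "p \<in> topspace ?D" for p
    using that by (auto simp: prod_simps)
  have "continuous_map ?D (total C)
     (\<lambda>p. (bmult B (fst (fst p)) (\<beta> (snd (fst p)) (fst (snd p))),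
           comp H (res (snd (fst p)) (proj B (fst (snd p)))) (snd (snd p))))"
    by (intro continuous_into_zappa_szep_bundle continuous_map_binary[OF continuous_bmult]
        continuous_map_binary[OF H.continuous_comp] continuous_map_binary[OF continuous_beta]
        continuous_map_binary[OF continuous_res] c proj)
      (use mem in \<open>auto simp: bundle_simps\<close>)
  then show ?thesis
    by (rule continuous_map_eq) (auto simp: zappa_szep_bundle_def)
qed

lemma continuous_bstar_zappa_szep_bundle: "continuous_map (total C) (total C) (bstar C)"
proof -
  have c: "continuous_map (total C) (total B) (\<lambda>c. bstar B (fst c))"
    "continuous_map (total C) (arrows H) (\<lambda>c. invs H (snd c))"
    using continuous_map_compose[OF continuous_zappa_szep_bundle_fst continuous_bstar]
      continuous_map_compose[OF continuous_zappa_szep_bundle_snd H.continuous_invs]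
    by (simp_all add: o_def)
  have proj: "continuous_map (total C) (arrows G) (\<lambda>c. invs G (proj B (fst c)))"
    using continuous_map_compose[OF continuous_map_compose[OF continuous_zappa_szep_bundle_fst
          continuous_proj] G.continuous_invs] by (simp add: o_def)
  have "continuous_map (total C) (total C)
     (\<lambda>c. (\<beta> (invs H (snd c)) (bstar B (fst c)), res (invs H (snd c)) (invs G (proj B (fst c)))))"
    by (intro continuous_into_zappa_szep_bundle continuous_map_binary[OF continuous_beta]
        continuous_map_binary[OF continuous_res] c proj)
      (auto simp: prod_simps bundle_simps)
  then show ?thesis
    by (rule continuous_map_eq) (auto simp: zappa_szep_bundle_def)
qed

text \<open>
  With \<open>y = p(b)\<close> and \<open>z = p(c)\<close>, both sides have first coordinate
  \<open>a \<beta>\<^sub>g(b) \<beta>\<^sub>l(\<beta>\<^sub>h(c))\<close> for \<open>l = g|\<^sub>y\<close>; the second coordinates agree by the rule for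
  restricting the product \<open>g|\<^sub>y h\<close> to \<open>z\<close>.
\<close>

lemma bmult_assoc_zappa_szep_bundle:
  assumes "(a, g) \<in> topspace (total C)" "(b, h) \<in> topspace (total C)" "(c, k) \<in> topspace (total C)"
    and "src H g = rng G (proj B b)" "src H h = rng G (proj B c)"
  shows "bmult C (bmult C (a, g) (b, h)) (c, k) = bmult C (a, g) (bmult C (b, h) (c, k))"
  using assms
  by (simp add: prod_simps bundle_simps bmult_assoc beta_bmult beta_comp res_comp comp_res
      H.comp_assoc)

lemma bstar_bstar_zappa_szep_bundle:
  assumes "(b, h) \<in> topspace (total C)"
  shows "bstar C (bstar C (b, h)) = (b, h)"
proof -
  interpret Z: etale_groupoid Z by (rule etale_groupoid_zappa_szep)
  let ?x = "proj B b" and ?k = "res (invs H h) (invs G (proj B b))"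
  have b: "b \<in> topspace (total B)" "h \<in> topspace (arrows H)" "src G ?x = rng H h"
    using assms by (simp_all add: prod_simps)
  have "bstar B (\<beta> (invs H h) (bstar B b)) = \<beta> ?k b"
    using b by (simp add: beta_bstar bundle_simps bstar_bstar)
  moreover have "\<beta> (invs H ?k) (\<beta> ?k b) = b"
    using b by (intro beta_invs_beta) (simp_all add: bundle_simps)
  moreover have "invs Z (invs Z (?x, h)) = (?x, h)"
    using b by (intro Z.invs_invs) (simp add: prod_simps bundle_simps)
  ultimately show ?thesis
    using b by (simp add: prod_simps bundle_simps)
qed

text \<open>
  With \<open>y = p(b)\<close> and \<open>k = g|\<^sub>y\<close>, compatibility gives
  \<open>(a \<beta>\<^sub>g(b))\<^sup>* = \<beta>\<^sub>k(b\<^sup>*) a\<^sup>*\<close>.  Applying \<open>k\<^sup>-\<^sup>1\<close> undoes \<open>\<beta>\<^sub>k\<close> on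
  \<open>b\<^sup>*\<close> and acts on \<open>a\<^sup>*\<close> through the restriction of \<open>k\<^sup>-\<^sup>1\<close> to
  \<open>k \<cdot> y\<^sup>-\<^sup>1\<close>, which is \<open>g\<^sup>-\<^sup>1\<close>.  The second coordinates agree since inversion in the
  groupoid \<open>Z\<close> reverses products.
\<close>

lemma bstar_bmult_zappa_szep_bundle:
  assumes "(a, g) \<in> topspace (total C)" "(b, h) \<in> topspace (total C)" "src H g = rng G (proj B b)"
  shows "bstar C (bmult C (a, g) (b, h)) = bmult C (bstar C (b, h)) (bstar C (a, g))"
proof -
  interpret Z: etale_groupoid Z by (rule etale_groupoid_zappa_szep)
  let ?x = "proj B a" and ?y = "proj B b" and ?k = "res g (proj B b)"
  have mem: "a \<in> topspace (total B)" "g \<in> topspace (arrows H)" "src G ?x = rng H g"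
      "b \<in> topspace (total B)" "h \<in> topspace (arrows H)" "src G ?y = rng H h"
      "src H g = rng G ?y"
    using assms by (simp_all add: prod_simps)
  note [simp] = mem bundle_simps
  have "bstar B (bmult B a (\<beta> g b)) = bmult B (\<beta> ?k (bstar B b)) (bstar B a)" (is "_ = ?m")
    by (simp add: bstar_bmult beta_bstar)
  then have "\<beta> (invs H (comp H ?k h)) (bstar B (bmult B a (\<beta> g b)))
      = \<beta> (invs H h) (\<beta> (invs H ?k) ?m)"
    using beta_comp[of "invs H h" "invs H ?k" ?m] by (simp add: H.invs_of_comp res_res_invs)
  also have "\<beta> (invs H ?k) ?m = bmult B (bstar B b) (\<beta> (invs H g) (bstar B a))"
    using beta_bmult[of "invs H ?k" "\<beta> ?k (bstar B b)" "bstar B a"]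
      invs_res[of ?k "invs G ?y"]
    by (simp add: beta_invs_beta res_res_invs)
  also have "\<beta> (invs H h) \<dots> = bmult B (\<beta> (invs H h) (bstar B b))
          (\<beta> (res (invs H h) (invs G ?y)) (\<beta> (invs H g) (bstar B a)))"
    by (simp add: beta_bmult)
  finally have "\<beta> (invs H (comp H ?k h)) (bstar B (bmult B a (\<beta> g b)))
      = bmult B (\<beta> (invs H h) (bstar B b))
          (\<beta> (res (invs H h) (invs G ?y)) (\<beta> (invs H g) (bstar B a)))" .
  moreover have "invs Z (comp Z (?x, g) (?y, h)) = comp Z (invs Z (?y, h)) (invs Z (?x, g))"
    by (intro Z.invs_of_comp) (simp_all add: prod_simps)
  ultimately show ?thesis
    by (simp add: prod_simps)
qed

text \<open>
  This formula reduces the \<open>C\<^sup>*\<close>-identity and positivity for \<open>C\<close> to those for \<open>B\<close>.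
\<close>

lemma bstar_bmult_self_zappa_szep_bundle:
  assumes "(b, h) \<in> topspace (total C)"
  shows "bmult C (bstar C (b, h)) (b, h)
    = (\<beta> (invs H h) (bmult B (bstar B b) b), ident H (src H h))"
proof -
  interpret Z: etale_groupoid Z by (rule etale_groupoid_zappa_szep)
  let ?x = "proj B b"
  have mem: "b \<in> topspace (total B)" "h \<in> topspace (arrows H)" "src G ?x = rng H h"
    using assms by (simp_all add: prod_simps)
  have "comp Z (invs Z (?x, h)) (?x, h) = ident Z (src Z (?x, h))"
    using mem by (intro Z.invs_comp) (simp add: prod_simps bundle_simps)
  then show ?thesis
    using mem by (simp add: prod_simps bundle_simps beta_bmult)
qed

text \<open>
  Multiplicative linear maps preserve inverses: if \<open>(c, \<mu>)\<close> inverts \<open>(a, - \<kappa>)\<close> in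
  the unitization, then its image inverts the image of \<open>(a, - \<kappa>)\<close>.  So the spectrum can only
  shrink.  The multiplication of \<open>C\<close> over a unit is that of \<open>B\<close>, as units of \<open>H\<close> act
  trivially.
\<close>

lemma fibre_positive_beta:
  assumes k: "k \<in> topspace (arrows H)" and pos: "fibre_positive B (ident G (src H k)) a"
  shows "fibre_positive C (ident Z (rng H k)) (\<beta> k a, ident H (rng H k))"
proof -
  let ?u = "ident G (src H k)" and ?v = "ident G (rng H k)" and ?e = "ident H (rng H k)"
  note [simp] = k bundle_simps act_ident
  have inv_e: "invs G ?v = ?v" "invs H ?e = ?e"
    using G.ident_comp[of ?v] H.ident_comp[of ?e]
    by (simp_all add: G.invs_unique[symmetric] H.invs_unique[symmetric])
  have res_e: "res ?e ?v = ?e" using res_ident[of ?e] by simp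
  have comp_e: "comp H ?e ?e = ?e" using H.ident_comp[of ?e] by simp
  have beta_e: "\<beta> ?e c = c" if "c \<in> topspace (total B)" "proj B c = ?v" for c
    using beta_ident[of c] that by simp
  have a: "a \<in> topspace (total B)" "proj B a = ?u" "bstar B a = a"
    and spec: "fibre_spectrum B ?u a \<subseteq> \<real>\<^sub>\<ge>\<^sub>0"
    using pos by (simp_all add: fibre_positive_def fibre_def)
  have fib: "(\<beta> k c, ?e) \<in> fibre C (ident Z (rng H k))"
    if "c \<in> topspace (total B)" "proj B c = ?u" for c
    using that by (simp add: fibre_def prod_simps)
  have "bstar C (\<beta> k a, ?e) = (\<beta> k a, ?e)"
    using a by (simp add: prod_simps inv_e res_e beta_bstar res_ident beta_e)
  moreover have "fibre_spectrum C (ident Z (rng H k)) (\<beta> k a, ?e) \<subseteq> fibre_spectrum B ?u a"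
  proof
    fix \<kappa> assume \<kappa>: "\<kappa> \<in> fibre_spectrum C (ident Z (rng H k)) (\<beta> k a, ?e)"
    have transport: "unitization_mult C ((\<beta> k c, ?e), \<mu>) ((\<beta> k d, ?e), \<nu>)
        = (bzero C (ident Z (rng H k)), 1)"
      if c: "c \<in> topspace (total B)" "proj B c = ?u" and d: "d \<in> topspace (total B)" "proj B d = ?u"
        and eq: "unitization_mult B (c, \<mu>) (d, \<nu>) = (bzero B ?u, 1)" for c d \<mu> \<nu>
    proof -
      let ?s = "badd B (bmult B c d) (badd B (bscale B \<mu> d) (bscale B \<nu> c))"
      have uu: "comp G ?u ?u = ?u" using G.ident_comp[of ?u] by simp
      have "\<beta> k ?s = badd B (bmult B (\<beta> k c) (\<beta> k d))
          (badd B (bscale B \<mu> (\<beta> k d)) (bscale B \<nu> (\<beta> k c)))"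
        using c d by (simp add: beta_add beta_scale beta_bmult res_ident uu)
      moreover have "\<beta> k (bzero B ?u) = bzero B ?v"
        using beta_bzero[of k ?u] by simp
      moreover have "?s = bzero B ?u" "\<mu> * \<nu> = 1"
        using eq by (simp_all add: unitization_mult_def)
      ultimately show ?thesis
        using c d by (simp add: unitization_mult_def prod_simps res_e comp_e beta_e)
    qed
    show "\<kappa> \<in> fibre_spectrum B ?u a"
    proof (rule ccontr)
      assume "\<kappa> \<notin> fibre_spectrum B ?u a"
      then obtain c \<mu> where c: "c \<in> topspace (total B)" "proj B c = ?u"
        and inv: "unitization_mult B (a, - \<kappa>) (c, \<mu>) = (bzero B ?u, 1)"
          "unitization_mult B (c, \<mu>) (a, - \<kappa>) = (bzero B ?u, 1)"
        by (auto simp: fibre_spectrum_def fibre_def)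
      have "unitization_mult C ((\<beta> k a, ?e), - \<kappa>) ((\<beta> k c, ?e), \<mu>) = (bzero C (ident Z (rng H k)), 1)"
        "unitization_mult C ((\<beta> k c, ?e), \<mu>) ((\<beta> k a, ?e), - \<kappa>) = (bzero C (ident Z (rng H k)), 1)"
        using transport[OF a(1,2) c inv(1)] transport[OF c a(1,2) inv(2)] by blast+
      then show False
        using \<kappa> fib[OF c] unfolding fibre_spectrum_def by blast
    qed
  qed
  ultimately show ?thesis
    using fib[OF a(1,2)] spec unfolding fibre_positive_def by blast
qed

theorem fell_bundle_zappa_szep: "fell_bundle Z C"
proof (intro fell_bundle.intro fell_bundle_axioms.intro etale_groupoid_zappa_szep
    usc_banach_bundle_zappa_szep continuous_bmult_zappa_szep_bundle
    continuous_bstar_zappa_szep_bundle)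
  note [simp] = prod_simps bundle_simps
  fix a b assume ab: "a \<in> topspace (total C)" "b \<in> topspace (total C)"
    "src Z (proj C a) = rng Z (proj C b)"
  show "bmult C a b \<in> topspace (total C)"
    "proj C (bmult C a b) = comp Z (proj C a) (proj C b)"
    using ab by (cases a; cases b; simp)+
  show "bmult C (bscale C \<kappa> a) b = bscale C \<kappa> (bmult C a b)"
    "bmult C a (bscale C \<kappa> b) = bscale C \<kappa> (bmult C a b)" for \<kappa>
    using ab by (cases a; cases b; simp add: bmult_scale_left bmult_scale_right beta_scale)+
  show "bnorm C (bmult C a b) \<le> bnorm C a * bnorm C b"
  proof -
    obtain a' g b' h where s: "a = (a', g)" "b = (b', h)" by (cases a, cases b)
    show ?thesis
      using bnorm_bmult[of a' "\<beta> g b'"] ab by (simp add: s bnorm_beta)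
  qed
  show "bstar C (bmult C a b) = bmult C (bstar C b) (bstar C a)"
  proof -
    obtain a' g b' h where s: "a = (a', g)" "b = (b', h)" by (cases a, cases b)
    show ?thesis
      unfolding s using ab by (intro bstar_bmult_zappa_szep_bundle) (simp_all add: s)
  qed
  fix c assume c: "c \<in> topspace (total C)"
  show "bmult C (bmult C a b) c = bmult C a (bmult C b c)"
    if "src Z (proj C b) = rng Z (proj C c)"
  proof -
    obtain a' g b' h c' k where s: "a = (a', g)" "b = (b', h)" "c = (c', k)"
      by (cases a, cases b, cases c)
    show ?thesis
      unfolding s using ab c that by (intro bmult_assoc_zappa_szep_bundle) (simp_all add: s)
  qed
next
  note [simp] = prod_simps bundle_simps
  fix a a' b assume "a \<in> topspace (total C)" "a' \<in> topspace (total C)" "b \<in> topspace (total C)"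
    "proj C a = proj C a'" "src Z (proj C a) = rng Z (proj C b)"
  then show "bmult C (badd C a a') b = badd C (bmult C a b) (bmult C a' b)"
    by (cases a; cases a'; cases b) (simp add: bmult_add_left)
next
  note [simp] = prod_simps bundle_simps
  fix a b b' assume "a \<in> topspace (total C)" "b \<in> topspace (total C)" "b' \<in> topspace (total C)"
    "proj C b = proj C b'" "src Z (proj C a) = rng Z (proj C b)"
  then show "bmult C a (badd C b b') = badd C (bmult C a b) (bmult C a b')"
    by (cases a; cases b; cases b') (simp add: bmult_add_right beta_add)
next
  note [simp] = prod_simps bundle_simps
  fix a b assume "a \<in> topspace (total C)" "b \<in> topspace (total C)" "proj C a = proj C b"
  then show "bstar C (badd C a b) = badd C (bstar C a) (bstar C b)"
    by (cases a; cases b) (simp add: bstar_add beta_add)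
next
  note [simp] = prod_simps bundle_simps
  fix c assume c: "c \<in> topspace (total C)"
  obtain b h where s: "c = (b, h)" by (cases c)
  have mem: "b \<in> topspace (total B)" "h \<in> topspace (arrows H)" "src G (proj B b) = rng H h"
    using c s by simp_all
  show "proj C (bstar C c) = invs Z (proj C c)"
    using mem by (simp add: s)
  show "bstar C (bscale C \<kappa> c) = bscale C (cnj \<kappa>) (bstar C c)" for \<kappa>
    using mem by (simp add: s bstar_scale beta_scale)
  show "bstar C (bstar C c) = c"
    using c unfolding s by (rule bstar_bstar_zappa_szep_bundle)
  note self = bstar_bmult_self_zappa_szep_bundle[OF c[unfolded s], folded s]
  show "bnorm C (bmult C (bstar C c) c) = (bnorm C c)\<^sup>2"
    unfolding self using mem by (simp add: s bnorm_beta bnorm_bstar_bmult G.invs_comp)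
  show "(bnorm C c)\<^sup>2 = (bnorm C (bstar C c))\<^sup>2"
    using mem bnorm_bstar[of b] by (simp add: s bnorm_beta)
  show "fibre_positive C (ident Z (src Z (proj C c))) (bmult C (bstar C c) c)"
    unfolding self
    using fibre_positive_beta[of "invs H h" "bmult B (bstar B b) b"] mem bstar_bmult_positive[of b]
    by (simp add: s)
qed

end

theorem theorem3p8:
  fixes G :: "('u, 'g) groupoid" and H :: "('u, 'h) groupoid"
    and act :: "'h \<Rightarrow> 'g \<Rightarrow> 'g" and res :: "'h \<Rightarrow> 'g \<Rightarrow> 'h"
    and B :: "('g, 'b) fell_bundle" and \<beta> :: "'h \<Rightarrow> 'b \<Rightarrow> 'b"
  assumes "matched_pair G H act res"
    and "fell_bundle G B"
    and "compatible_action G H act res B \<beta>"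
  shows "fell_bundle (zappa_szep G H act res) (zappa_szep_bundle G H res B \<beta>)"
  using assms(3) by (rule compatible_action.fell_bundle_zappa_szep)

end
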